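(* (a) If $d\ge2$, then there is a non-cyclic $f\in H^2_d$ such that every slice function $f_z$, $z\in\partial\mathbb B_d$, is outer in $H^2(\mathbb D)$. (b) Let $d,k,n$ be integers with $d\ge k\ge4n>0$ and let $p(\lambda)=1-\lambda$, $\lambda\in\mathbb D$. Then the polynomial $T_{k,d}\,p$ does not belong to $\mathcal C_{n-1}(H^2_d)$. Hence $\mathbb C_{\mathrm{stable}}[z]\nsubseteq\mathcal C_{n-1}(H^2_d)$.
   Context: $\mathbb B_d$ is the open unit ball of $\mathbb C^d$, $\mathbb D=\mathbb B_1$. The Drury-Arveson space $H^2_d$ is the Hilbert space of analytic functions $f(z)=\sum_{\alpha\in\mathbb N_0^d}\hat f(\alpha)z^\alpha$ on $\mathbb B_d$ with $\|f\|^2_{H^2_d}=\sum_{\alpha\in\mathbb N_0^d}\frac{\alpha!}{|\alpha|!}|\hat f(\alpha)|^2<\infty$. $\mathrm{Mult}(H^2_d)=\{\varphi:\varphi f\in H^2_d\text{ for all }f\in H^2_d\}$; for $f\in H^2_d$, $[f]$ is the closure in $H^2_d$ of $\{\varphi f:\varphi\in\mathrm{Mult}(H^2_d)\}$; $f$ is cyclic if $[f]=H^2_d$; for integers $m\ge0$, $\mathcal C_m(H^2_d)=\{\varphi\in\mathrm{Mult}(H^2_d):\varphi\ne0,\ [\varphi^m]=[\varphi^{m+1}]\}$, with $\varphi^0=1$. The slice function of $f$ at $z\in\partial\mathbb B_d$ is $f_z(\lambda)=f(\lambda z)$, $\lambda\in\mathbb D$. $\mathbb C_{\mathrm{stable}}[z]$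 is the set of $d$-variable complex polynomials with no zeros in $\mathbb B_d$. For $1\le k\le d$ let $\tau_k(z)=k^{k/2}\prod_{j=1}^kz_j$, which maps $\mathbb B_d$ into $\mathbb D$, and for $f$ analytic in $\mathbb D$ let $T_{k,d}f=f\circ\tau_k$. *)

theory Defs
  imports "HOL-Analysis.Analysis"
begin

text \<open>
  \<open>\<complex>\<^sup>d\<close> is \<^typ>\<open>complex ^ 'd\<close> with \<open>d = CARD('d)\<close>, its open unit ball is \<^term>\<open>ball 0 1\<close>, and
  multi-indices are functions \<^typ>\<open>'d \<Rightarrow> nat\<close>.  A function on the unit ball (or disc) is
  represented by a total function whose values outside are irrelevant: every notion
  below depends only on the values in the open ball, and every set of functions is
  closed under changing values outside it.
\<close>

definition monomial :: "('d::finite \<Rightarrow> nat) \<Rightarrow> complex ^ 'd \<Rightarrow> complex" where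
  "monomial \<alpha> z = (\<Prod>i\<in>UNIV. (z $ i) ^ \<alpha> i)"

definition has_power_series :: "(complex ^ 'd::finite \<Rightarrow> complex) \<Rightarrow> (('d \<Rightarrow> nat) \<Rightarrow> complex) \<Rightarrow> bool" where
  "has_power_series f a \<longleftrightarrow>
     (\<forall>z\<in>ball 0 1. ((\<lambda>\<alpha>. a \<alpha> * monomial \<alpha> z) has_sum f z) UNIV)"

definition analytic_ball :: "(complex ^ 'd::finite \<Rightarrow> complex) \<Rightarrow> bool" where
  "analytic_ball f \<longleftrightarrow> (\<exists>a. has_power_series f a)"

definition taylor_coeff :: "(complex ^ 'd::finite \<Rightarrow> complex) \<Rightarrow> ('d \<Rightarrow> nat) \<Rightarrow> complex" where
  "taylor_coeff f = (THE a. has_power_series f a)"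

definition DA_weight :: "('d::finite \<Rightarrow> nat) \<Rightarrow> real" where
  "DA_weight \<alpha> = (\<Prod>i\<in>UNIV. fact (\<alpha> i)) / fact (\<Sum>i\<in>UNIV. \<alpha> i)"

definition drury_arveson :: "(complex ^ 'd::finite \<Rightarrow> complex) set" where
  "drury_arveson =
     {f. analytic_ball f \<and> (\<lambda>\<alpha>. DA_weight \<alpha> * (cmod (taylor_coeff f \<alpha>))\<^sup>2) summable_on UNIV}"

definition DA_norm :: "(complex ^ 'd::finite \<Rightarrow> complex) \<Rightarrow> real" where
  "DA_norm f = sqrt (\<Sum>\<^sub>\<infinity>\<alpha>\<in>UNIV. DA_weight \<alpha> * (cmod (taylor_coeff f \<alpha>))\<^sup>2)"

definition multipliers :: "(complex ^ 'd::finite \<Rightarrow> complex) set" where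
  "multipliers = {\<phi>. \<forall>f\<in>drury_arveson. (\<lambda>z. \<phi> z * f z) \<in> drury_arveson}"

definition inv_subspace :: "(complex ^ 'd::finite \<Rightarrow> complex) \<Rightarrow> (complex ^ 'd \<Rightarrow> complex) set" where
  "inv_subspace f =
     {g \<in> drury_arveson. \<forall>\<epsilon>>0. \<exists>\<phi>\<in>multipliers. DA_norm (\<lambda>z. \<phi> z * f z - g z) < \<epsilon>}"

definition cyclic :: "(complex ^ 'd::finite \<Rightarrow> complex) \<Rightarrow> bool" where
  "cyclic f \<longleftrightarrow> inv_subspace f = drury_arveson"

definition cyclicity_class :: "nat \<Rightarrow> (complex ^ 'd::finite \<Rightarrow> complex) set" where
  "cyclicity_class m =
     {\<phi> \<in> multipliers. (\<exists>z\<in>ball 0 1. \<phi> z \<noteq> 0) \<and>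
        inv_subspace (\<lambda>z. \<phi> z ^ m) = inv_subspace (\<lambda>z. \<phi> z ^ (m + 1))}"

definition slice :: "(complex ^ 'd::finite \<Rightarrow> complex) \<Rightarrow> complex ^ 'd \<Rightarrow> complex \<Rightarrow> complex" where
  "slice f z = (\<lambda>l. f (l *s z))"

definition hardy2 :: "(complex \<Rightarrow> complex) set" where
  "hardy2 = {g. \<exists>a :: nat \<Rightarrow> complex. summable (\<lambda>n. (cmod (a n))\<^sup>2) \<and>
                 (\<forall>l\<in>ball 0 1. (\<lambda>n. a n * l ^ n) sums g l)}"

text \<open>
  Outer functions in the classical sense (Rudin, Real and Complex Analysis, 17.14), with
  the positive function \<open>\<psi>\<close> on the circle parametrised by the angle \<open>t \<in> [0, 2\<pi>]\<close>.
\<close>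

definition outer_hardy2 :: "(complex \<Rightarrow> complex) \<Rightarrow> bool" where
  "outer_hardy2 g \<longleftrightarrow> g \<in> hardy2 \<and>
     (\<exists>(c::complex) (\<psi> :: real \<Rightarrow> real).
        cmod c = 1 \<and> \<psi> \<in> borel_measurable lebesgue \<and> (\<forall>t. \<psi> t > 0) \<and>
        set_integrable lebesgue {0..2*pi} (\<lambda>t. ln (\<psi> t)) \<and>
        (\<forall>l\<in>ball 0 1.
           g l = c * exp (1 / (2 * pi) *
             (LINT t:{0..2*pi}|lebesgue. (cis t + l) / (cis t - l) * ln (\<psi> t)))))"

definition stable_polynomials :: "(complex ^ 'd::finite \<Rightarrow> complex) set" where
  "stable_polynomials =
     {p. (\<exists>A c. finite A \<and> p = (\<lambda>z. \<Sum>\<alpha>\<in>A. c \<alpha> * monomial \<alpha> z)) \<and> (\<forall>z\<in>ball 0 1. p z \<noteq> 0)}"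

text \<open>
  The argument \<open>e\<close> is an enumeration of the coordinates by \<open>{1..d}\<close>, so that the
  \<open>j\<close>-th coordinate of \<open>z\<close> is \<open>z $ e j\<close>.
\<close>

definition tau :: "(nat \<Rightarrow> 'd::finite) \<Rightarrow> nat \<Rightarrow> complex ^ 'd \<Rightarrow> complex" where
  "tau e k z = of_real (real k powr (real k / 2)) * (\<Prod>j=1..k. z $ e j)"

definition T_op :: "(nat \<Rightarrow> 'd::finite) \<Rightarrow> nat \<Rightarrow> (complex \<Rightarrow> complex) \<Rightarrow> complex ^ 'd \<Rightarrow> complex" where
  "T_op e k f = f \<circ> tau e k"

end

theory Submission
  imports Defs "HOL-Complex_Analysis.Complex_Analysis"
begin

text \<open>
  Both parts rest on one obstruction.  Let \<open>J\<close> be a set of \<open>k\<close> coordinates and let \<open>\<tau>\<close> be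
  \<open>k\<^bsup>k/2\<^esup>\<close> times their product.  The powers of \<open>\<tau>\<close> are orthogonal in the Drury-Arveson space, and
  \<open>\<parallel>\<tau>\<^sup>m\<parallel>\<^sup>2 \<ge> (m + 1)\<^bsup>(k-1)/2\<^esup>\<close> (lemma \<open>diag_weight_ge\<close>).  Hence, if
  \<open>\<Sum> \<bar>\<nu>\<^sub>m\<bar>\<^sup>2 (m + 1)\<^bsup>-(k-1)/2\<^esup>\<close> converges, then \<open>F \<mapsto> \<Sum> \<nu>\<^sub>m c\<^sub>m(F)\<close> is a bounded functional, where \<open>c\<^sub>m(F)\<close>
  is the coefficient of \<open>\<tau>\<^sup>m\<close> in \<open>F\<close>.  Multiplication by \<open>f \<circ> \<tau>\<close> convolves the sequence \<open>c(u)\<close> with the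
  coefficients of \<open>f\<close>.  So if \<open>\<Sum>\<^sub>i f\<^sub>i \<nu>\<^sub>i\<^sub>+\<^sub>j = 0\<close> for all \<open>j\<close> and the \<open>f\<^sub>i\<close> decay, the functional kills
  \<open>u (f \<circ> \<tau>)\<close> for every multiplier \<open>u\<close> (lemma \<open>Hankel_annihilation\<close>), and each \<open>g \<circ> \<tau>\<close> that it does not
  kill lies outside \<open>[f \<circ> \<tau>]\<close> (lemma \<open>not_in_inv_subspace\<close>).

  For the polynomials, \<open>\<nu>\<^sub>m\<close> is the binomial coefficient of \<open>m\<close> over \<open>n - 1\<close>: the functional is a multiple
  of the derivative of order \<open>n - 1\<close> at the boundary point \<open>1\<close>.  It is bounded because \<open>k \<ge> 4n\<close> gives
  \<open>2 (n - 1) - (k - 1) / 2 \<le> - 3/2\<close>; it kills the multiples of \<open>(1 - \<tau>)\<^sup>n\<close> but not \<open>(1 - \<tau>)\<^bsup>n-1\<^esup>\<close>.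

  For the function with outer slices, \<open>k = 2\<close>, the weight is \<open>(m + 1)\<^bsup>1/2\<^esup>\<close>, and \<open>\<nu>\<close> is the sequence of
  moments of the uniform measure on the Cantor set of all \<open>exp(2 \<pi> \<i> x)\<close> where \<open>x\<close> has only the ternary digits
  \<open>0\<close> and \<open>1\<close>.  Its dimension \<open>log 2 / log 3\<close> exceeds \<open>1/2\<close>, so the measure has finite energy
  (lemma \<open>cantor_limit_square_summable\<close>).  What remains is an outer \<open>f\<close> with decaying coefficients that
  vanishes on this set.  It is \<open>f = exp(-G)\<close>, where \<open>G\<close> is a positive combination of the functions
  \<open>1 / (r - z \<zeta>\<^sup>*)\<close> with \<open>\<zeta>\<close> in the Cantor set, \<open>\<zeta>\<^sup>*\<close> its conjugate, and \<open>r > 1\<close>.  Near the set \<open>Re G\<close> grows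
  like a power of the inverse distance, so \<open>exp(-G)\<close> outweighs every pole of the derivatives of \<open>G\<close> and
  \<open>f''\<close> is bounded (lemma \<open>norm_cantor_outer_second_deriv_le\<close>); this makes the coefficients \<open>O(1/i\<^sup>2)\<close>.  A slice is
  \<open>\<lambda> \<mapsto> f(c \<lambda>\<^sup>2)\<close> with \<open>\<bar>c\<bar> \<le> 1\<close>, and its logarithm is minus a series of functions that are
  continuous on the closed disc and have nonnegative real part.  The Schwarz integral formula holds for each
  term and, by positivity, for the sum (lemma \<open>outer_exp_neg_sum\<close>), so every slice is outer.
\<close>

section \<open>Power series in several variables and the Drury-Arveson space\<close>

lemma monomial_scale: "monomial \<alpha> (t *s z) = t ^ (sum \<alpha> UNIV) * monomial \<alpha> z"
  by (simp add: monomial_def power_mult_distrib prod.distrib power_sum)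

lemma monomial_mult_arg:
  "monomial \<alpha> (\<chi> i. z $ i * w $ i) = monomial \<alpha> z * monomial \<alpha> w"
  by (simp add: monomial_def power_mult_distrib prod.distrib)

lemma monomial_add_index: "monomial (\<lambda>i. \<alpha> i + \<beta> i) z = monomial \<alpha> z * monomial \<beta> z"
  by (simp add: monomial_def power_add prod.distrib)

lemma monomial_zero_index [simp]: "monomial (\<lambda>i. 0) z = 1"
  by (simp add: monomial_def)

lemma monomials_separate:
  fixes \<alpha> \<beta> :: "'d::finite \<Rightarrow> nat"
  assumes "\<alpha> \<noteq> \<beta>"
  obtains w where "monomial \<alpha> w \<noteq> monomial \<beta> w"
proof -
  from assms obtain i where i: "\<alpha> i \<noteq> \<beta> i" by auto
  define w :: "complex ^ 'd" where "w = (\<chi> j. if j = i then 2 else 1)"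
  have m: "monomial \<gamma> w = 2 ^ \<gamma> i" for \<gamma> :: "'d \<Rightarrow> nat"
  proof -
    have "monomial \<gamma> w = (\<Prod>j\<in>UNIV. if j = i then 2 ^ \<gamma> i else 1)"
      unfolding monomial_def w_def by (rule prod.cong) auto
    then show ?thesis by simp
  qed
  have "(2::complex) ^ \<alpha> i \<noteq> 2 ^ \<beta> i"
  proof
    assume "(2::complex) ^ \<alpha> i = 2 ^ \<beta> i"
    then have "cmod (2 ^ \<alpha> i) = cmod (2 ^ \<beta> i)" by simp
    then have "(2::real) ^ \<alpha> i = 2 ^ \<beta> i" by (simp add: norm_power)
    then show False using i by simp
  qed
  with that m show thesis by metis
qed

text \<open>
  Monomials are multiplicative in the point \<open>z\<close>, so this is Dedekind's argument for the independence of
  characters: comparing the relation at \<open>z w\<close> with \<open>monomial \<beta> w\<close> times the relation at \<open>z\<close> eliminates \<open>\<beta>\<close>.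
\<close>

lemma monomials_independent:
  fixes A :: "('d::finite \<Rightarrow> nat) set"
  assumes "finite A" and "\<And>z. (\<Sum>\<alpha>\<in>A. b \<alpha> * monomial \<alpha> z) = 0" and "\<alpha> \<in> A"
  shows "b \<alpha> = 0"
  using assms
proof (induction A arbitrary: b \<alpha> rule: finite_induct)
  case empty
  then show ?case by simp
next
  case (insert \<beta> A)
  have diff: "(\<Sum>\<alpha>\<in>A. (b \<alpha> * (monomial \<alpha> w - monomial \<beta> w)) * monomial \<alpha> z) = 0" for w z
  proof -
    have "(\<Sum>\<alpha>\<in>insert \<beta> A. b \<alpha> * monomial \<alpha> (\<chi> i. z $ i * w $ i))
            - monomial \<beta> w * (\<Sum>\<alpha>\<in>insert \<beta> A. b \<alpha> * monomial \<alpha> z) = 0"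
      using insert.prems(1)[of "\<chi> i. z $ i * w $ i"] insert.prems(1)[of z] by simp
    then show ?thesis
      using insert.hyps
      by (simp add: monomial_mult_arg sum_distrib_left algebra_simps sum_subtractf)
  qed
  have zero: "b \<gamma> = 0" if "\<gamma> \<in> A" for \<gamma>
  proof -
    from that insert.hyps have "\<gamma> \<noteq> \<beta>" by auto
    then obtain w where w: "monomial \<gamma> w \<noteq> monomial \<beta> w" by (rule monomials_separate)
    have "b \<gamma> * (monomial \<gamma> w - monomial \<beta> w) = 0"
      by (rule insert.IH[where b = "\<lambda>\<alpha>. b \<alpha> * (monomial \<alpha> w - monomial \<beta> w)"])
         (use diff that in auto)
    with w show ?thesis by simp
  qed
  have "b \<beta> = 0"
  proof -
    have "(\<Sum>\<alpha>\<in>insert \<beta> A. b \<alpha> * monomial \<alpha> (1 :: complex ^ 'd)) = 0" by (rule insert.prems(1))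
    moreover have "monomial \<beta> (1 :: complex ^ 'd) = 1" by (simp add: monomial_def)
    ultimately show ?thesis using insert.hyps zero by simp
  qed
  with zero insert.prems(2) show ?case by auto
qed

lemma finite_bounded_indices: "finite {\<alpha> :: 'd::finite \<Rightarrow> nat. \<forall>i. \<alpha> i \<le> \<beta> i}"
proof -
  have "{\<alpha> :: 'd \<Rightarrow> nat. \<forall>i. \<alpha> i \<le> \<beta> i} = PiE UNIV (\<lambda>i. {..\<beta> i})"
    by (auto simp: PiE_def Pi_def extensional_def)
  then show ?thesis by (simp add: finite_PiE)
qed

lemma finite_indices_of_degree: "finite {\<alpha> :: 'd::finite \<Rightarrow> nat. sum \<alpha> UNIV = n}"
proof (rule finite_subset[OF _ finite_bounded_indices])
  show "{\<alpha> :: 'd \<Rightarrow> nat. sum \<alpha> UNIV = n} \<subseteq> {\<alpha>. \<forall>i. \<alpha> i \<le> n}"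
    by (auto intro!: member_le_sum)
qed

lemma power_series_zero_coeffs:
  fixes a :: "nat \<Rightarrow> complex"
  assumes "\<And>t. cmod t < 1 \<Longrightarrow> (\<lambda>n. a n * t ^ n) sums 0"
  shows "a n = 0"
proof (rule ccontr)
  assume an: "a n \<noteq> 0"
  have "a 0 = 0" using assms[of 0] by simp
  with an have n: "n > 0" by (cases n) auto
  obtain s where s: "0 < s" "\<And>z::complex. z \<in> cball 0 s - {0} \<Longrightarrow> (0::complex) \<noteq> 0"
    using powser_0_nonzero[of 1 0 a "\<lambda>_. 0" n] assms an n by auto
  from s(2)[of "of_real s"] s(1) show False by auto
qed

text \<open>
  On the disc \<open>t \<mapsto> t z\<close> the series becomes a power series in \<open>t\<close> whose coefficients are the
  homogeneous parts at \<open>z\<close>.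
\<close>

lemma homogeneous_parts_vanish:
  fixes c :: "('d::finite \<Rightarrow> nat) \<Rightarrow> complex"
  assumes "\<And>z. z \<in> ball 0 1 \<Longrightarrow> ((\<lambda>\<alpha>. c \<alpha> * monomial \<alpha> z) has_sum 0) UNIV"
  assumes z: "z \<in> ball 0 1"
  shows "(\<Sum>\<alpha>\<in>{\<alpha>. sum \<alpha> UNIV = n}. c \<alpha> * monomial \<alpha> z) = 0"
proof -
  define D where "D n = {\<alpha> :: 'd \<Rightarrow> nat. sum \<alpha> UNIV = n}" for n
  define P where "P n = (\<Sum>\<alpha>\<in>D n. c \<alpha> * monomial \<alpha> z)" for n
  have "(\<lambda>n. P n * t ^ n) sums 0" if t: "cmod t < 1" for t
  proof -
    have "norm (t *s z) \<le> norm z"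
    proof -
      have "norm (t *s z) = cmod t * norm z"
        by (simp add: norm_vec_def norm_mult L2_set_right_distrib)
      then show ?thesis using t by (simp add: mult_left_le_one_le)
    qed
    then have "t *s z \<in> ball 0 1" using z by auto
    then have "((\<lambda>\<alpha>. c \<alpha> * monomial \<alpha> (t *s z)) has_sum 0) UNIV" by (rule assms(1))
    then have "((\<lambda>(n, \<alpha>). c \<alpha> * monomial \<alpha> (t *s z)) has_sum 0) (Sigma UNIV D)"
      by (subst has_sum_reindex_bij_witness[where T = UNIV and j = snd and i = "\<lambda>\<alpha>. (sum \<alpha> UNIV, \<alpha>)"
            and h = "\<lambda>\<alpha>. c \<alpha> * monomial \<alpha> (t *s z)" and s' = 0])
         (auto simp: D_def)
    then have "((\<lambda>n. \<Sum>\<alpha>\<in>D n. c \<alpha> * monomial \<alpha> (t *s z)) has_sum 0) UNIV"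
      by (rule has_sum_SigmaD)
         (auto intro!: has_sum_finite simp: D_def finite_indices_of_degree)
    also have "(\<lambda>n. \<Sum>\<alpha>\<in>D n. c \<alpha> * monomial \<alpha> (t *s z)) = (\<lambda>n. P n * t ^ n)"
      unfolding P_def sum_distrib_right
      by (intro ext sum.cong) (auto simp: D_def monomial_scale)
    finally show ?thesis by (rule has_sum_imp_sums)
  qed
  then have "P n = 0" by (rule power_series_zero_coeffs)
  then show ?thesis by (simp add: P_def D_def)
qed

lemma has_sum_diff_complex:
  fixes f g :: "'a \<Rightarrow> complex"
  assumes "(f has_sum s) A" "(g has_sum t) A"
  shows "((\<lambda>x. f x - g x) has_sum (s - t)) A"
  using has_sum_add[OF assms(1) has_sum_uminusI[OF assms(2)]] by simp

text \<open>
  The coefficient map \<open>taylor_coeff\<close> is a definite description, so every norm computation depends on this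
  uniqueness.
\<close>

lemma has_power_series_unique:
  fixes f :: "complex ^ 'd::finite \<Rightarrow> complex"
  assumes "has_power_series f a" "has_power_series f b"
  shows "a = b"
proof
  fix \<alpha> :: "'d \<Rightarrow> nat"
  define c where "c \<alpha> = a \<alpha> - b \<alpha>" for \<alpha>
  define n where "n = sum \<alpha> UNIV"
  have c: "((\<lambda>\<alpha>. c \<alpha> * monomial \<alpha> z) has_sum 0) UNIV" if "z \<in> ball 0 1" for z
    using has_sum_diff_complex[of "\<lambda>\<alpha>. a \<alpha> * monomial \<alpha> z" UNIV "f z" "\<lambda>\<alpha>. b \<alpha> * monomial \<alpha> z" "f z"]
      assms that by (simp add: has_power_series_def c_def algebra_simps)
  have "(\<Sum>\<alpha>\<in>{\<alpha>. sum \<alpha> UNIV = n}. c \<alpha> * monomial \<alpha> z) = 0" for z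
  proof -
    \<comment> \<open>Homogeneity extends the vanishing from the ball to all points.\<close>
    define t where "t = complex_of_real (inverse (2 * (1 + norm z)))"
    have pos: "1 + norm z > 0" by (smt (verit) norm_ge_zero)
    then have "inverse (2 * (1 + norm z)) \<noteq> 0" by simp
    then have t0: "t \<noteq> 0" unfolding t_def of_real_eq_0_iff .
    have "norm (t *s z) = cmod t * norm z"
      by (simp add: norm_vec_def norm_mult L2_set_right_distrib)
    also have "\<dots> < 1"
    proof -
      have "cmod t = inverse (2 * (1 + norm z))" 
        unfolding t_def using pos by (simp only: norm_of_real) simp
      then have "cmod t * (2 * (1 + norm z)) = 1" using pos by simp
      then have "2 * (cmod t * norm z) + 2 * cmod t = 1" by (simp add: algebra_simps)
      then show ?thesis using norm_ge_zero[of t] by linarith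
    qed
    finally have "t *s z \<in> ball 0 1" by simp
    then have "(\<Sum>\<alpha>\<in>{\<alpha>. sum \<alpha> UNIV = n}. c \<alpha> * monomial \<alpha> (t *s z)) = 0"
      by (rule homogeneous_parts_vanish[rotated]) (rule c)
    also have "(\<Sum>\<alpha>\<in>{\<alpha>. sum \<alpha> UNIV = n}. c \<alpha> * monomial \<alpha> (t *s z))
        = t ^ n * (\<Sum>\<alpha>\<in>{\<alpha>. sum \<alpha> UNIV = n}. c \<alpha> * monomial \<alpha> z)"
      unfolding sum_distrib_left by (intro sum.cong) (auto simp: monomial_scale)
    finally show ?thesis using t0 by simp
  qed
  from monomials_independent[OF finite_indices_of_degree this, of \<alpha>]
  show "a \<alpha> = b \<alpha>" by (simp add: c_def n_def)
qed

lemma taylor_coeff_eq: "has_power_series f a \<Longrightarrow> taylor_coeff f = a"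
  unfolding taylor_coeff_def by (rule the_equality) (auto intro: has_power_series_unique)

lemma drury_arveson_iff:
  assumes "has_power_series f a"
  shows "f \<in> drury_arveson \<longleftrightarrow> (\<lambda>\<alpha>. DA_weight \<alpha> * (cmod (a \<alpha>))\<^sup>2) summable_on UNIV"
  using assms by (auto simp: drury_arveson_def analytic_ball_def taylor_coeff_eq)

lemma drury_arveson_power_series:
  assumes "f \<in> drury_arveson"
  obtains a where "has_power_series f a"
  using assms by (auto simp: drury_arveson_def analytic_ball_def)

lemma has_power_series_diff:
  assumes "has_power_series f a" "has_power_series g b"
  shows "has_power_series (\<lambda>z. f z - g z) (\<lambda>\<alpha>. a \<alpha> - b \<alpha>)"
  using assms by (auto simp: has_power_series_def left_diff_distrib intro!: has_sum_diff_complex)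

lemma DA_weight_nonneg: "DA_weight \<alpha> \<ge> 0"
  by (simp add: DA_weight_def prod_nonneg)

lemma drury_arveson_diff:
  assumes "f \<in> drury_arveson" "g \<in> drury_arveson"
  shows "(\<lambda>z. f z - g z) \<in> drury_arveson"
proof -
  obtain a where a: "has_power_series f a" using assms(1) by (rule drury_arveson_power_series)
  obtain b where b: "has_power_series g b" using assms(2) by (rule drury_arveson_power_series)
  have "(\<lambda>\<alpha>. 2 * (DA_weight \<alpha> * (cmod (a \<alpha>))\<^sup>2) + 2 * (DA_weight \<alpha> * (cmod (b \<alpha>))\<^sup>2)) summable_on UNIV"
    using assms drury_arveson_iff[OF a] drury_arveson_iff[OF b]
    by (intro summable_on_add summable_on_cmult_right) auto
  then have "(\<lambda>\<alpha>. DA_weight \<alpha> * (cmod (a \<alpha> - b \<alpha>))\<^sup>2) summable_on UNIV"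
  proof (rule summable_on_comparison_test)
    fix \<alpha>
    have "(cmod (a \<alpha> - b \<alpha>))\<^sup>2 \<le> (cmod (a \<alpha>) + cmod (b \<alpha>))\<^sup>2"
      by (intro power_mono norm_triangle_ineq4) auto
    also have "\<dots> \<le> 2 * (cmod (a \<alpha>))\<^sup>2 + 2 * (cmod (b \<alpha>))\<^sup>2"
      using sum_squares_bound[of "cmod (a \<alpha>)" "cmod (b \<alpha>)"] by (simp add: power2_sum)
    finally have "DA_weight \<alpha> * (cmod (a \<alpha> - b \<alpha>))\<^sup>2
        \<le> DA_weight \<alpha> * (2 * (cmod (a \<alpha>))\<^sup>2 + 2 * (cmod (b \<alpha>))\<^sup>2)"
      by (intro mult_left_mono DA_weight_nonneg)
    then show "DA_weight \<alpha> * (cmod (a \<alpha> - b \<alpha>))\<^sup>2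
        \<le> 2 * (DA_weight \<alpha> * (cmod (a \<alpha>))\<^sup>2) + 2 * (DA_weight \<alpha> * (cmod (b \<alpha>))\<^sup>2)"
      by (simp add: algebra_simps)
  qed (auto simp: DA_weight_nonneg)
  then show ?thesis using drury_arveson_iff[OF has_power_series_diff[OF a b]] by simp
qed

lemma has_power_series_mult:
  fixes f g :: "complex ^ 'd::finite \<Rightarrow> complex"
  assumes f: "has_power_series f a" and g: "has_power_series g b"
  shows "has_power_series (\<lambda>z. f z * g z)
           (\<lambda>\<beta>. \<Sum>\<alpha>\<in>{\<alpha>. \<forall>i. \<alpha> i \<le> \<beta> i}. a \<alpha> * b (\<lambda>i. \<beta> i - \<alpha> i))"
  unfolding has_power_series_def
proof
  fix z :: "complex ^ 'd" assume z: "z \<in> ball 0 1"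
  define B where "B \<beta> = {\<alpha> :: 'd \<Rightarrow> nat. \<forall>i. \<alpha> i \<le> \<beta> i}" for \<beta>
  define x where "x \<alpha> = a \<alpha> * monomial \<alpha> z" for \<alpha>
  define y where "y \<alpha> = b \<alpha> * monomial \<alpha> z" for \<alpha>
  have hx: "(x has_sum f z) UNIV" using f z by (simp add: has_power_series_def x_def[abs_def])
  have hy: "(y has_sum g z) UNIV" using g z by (simp add: has_power_series_def y_def[abs_def])
  have ax: "(\<lambda>\<alpha>. norm (x \<alpha>)) summable_on UNIV"
    and ay: "(\<lambda>\<alpha>. norm (y \<alpha>)) summable_on UNIV"
    using hx hy by (auto simp: summable_on_iff_abs_summable_on_complex[symmetric] dest: has_sum_imp_summable)
  have "(\<lambda>p. norm ((\<lambda>(\<alpha>, \<beta>). x \<alpha> * y \<beta>) p)) summable_on UNIV \<times> UNIV"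
  proof (subst Infinite_Sum.abs_summable_on_Sigma_iff, intro conjI ballI)
    show "(\<lambda>\<beta>. norm (case (\<alpha>, \<beta>) of (\<alpha>, \<beta>) \<Rightarrow> x \<alpha> * y \<beta>)) summable_on UNIV" for \<alpha>
      using ay by (simp add: norm_mult summable_on_cmult_right)
    show "(\<lambda>\<alpha>. norm (\<Sum>\<^sub>\<infinity>\<beta>. norm (case (\<alpha>, \<beta>) of (\<alpha>, \<beta>) \<Rightarrow> x \<alpha> * y \<beta>))) summable_on UNIV"
      using ax by (simp add: norm_mult infsum_cmult_right' summable_on_cmult_left infsum_nonneg)
  qed
  then have "(\<lambda>(\<alpha>, \<beta>). x \<alpha> * y \<beta>) summable_on UNIV \<times> UNIV"
    by (rule abs_summable_summable)
  then have "((\<lambda>(\<alpha>, \<beta>). x \<alpha> * y \<beta>) has_sum (f z * g z)) (UNIV \<times> UNIV)"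
    by (intro has_sum_SigmaI[where g = "\<lambda>\<alpha>. x \<alpha> * g z"])
       (auto intro: has_sum_cmult_right has_sum_cmult_left hx hy)
  also have "((\<lambda>(\<alpha>, \<beta>). x \<alpha> * y \<beta>) has_sum (f z * g z)) (UNIV \<times> UNIV) \<longleftrightarrow>
      ((\<lambda>(\<beta>, \<alpha>). x \<alpha> * y (\<lambda>i. \<beta> i - \<alpha> i)) has_sum (f z * g z)) (Sigma UNIV B)"
    by (rule has_sum_reindex_bij_witness[where j = "\<lambda>(\<alpha>, \<beta>). (\<lambda>i. \<alpha> i + \<beta> i, \<alpha>)"
          and i = "\<lambda>(\<beta>, \<alpha>). (\<alpha>, \<lambda>i. \<beta> i - \<alpha> i)"]) (auto simp: B_def)
  finally have "((\<lambda>\<beta>. \<Sum>\<alpha>\<in>B \<beta>. x \<alpha> * y (\<lambda>i. \<beta> i - \<alpha> i)) has_sum (f z * g z)) UNIV"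
    by (rule has_sum_SigmaD) (auto intro!: has_sum_finite simp: B_def finite_bounded_indices)
  also have "(\<lambda>\<beta>. \<Sum>\<alpha>\<in>B \<beta>. x \<alpha> * y (\<lambda>i. \<beta> i - \<alpha> i))
     = (\<lambda>\<beta>. (\<Sum>\<alpha>\<in>B \<beta>. a \<alpha> * b (\<lambda>i. \<beta> i - \<alpha> i)) * monomial \<beta> z)"
  proof
    fix \<beta>
    show "(\<Sum>\<alpha>\<in>B \<beta>. x \<alpha> * y (\<lambda>i. \<beta> i - \<alpha> i)) = (\<Sum>\<alpha>\<in>B \<beta>. a \<alpha> * b (\<lambda>i. \<beta> i - \<alpha> i)) * monomial \<beta> z"
      unfolding sum_distrib_right
    proof (rule sum.cong)
      fix \<alpha> assume "\<alpha> \<in> B \<beta>"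
      then have "monomial \<beta> z = monomial \<alpha> z * monomial (\<lambda>i. \<beta> i - \<alpha> i) z"
        by (subst monomial_add_index[symmetric]) (simp add: B_def)
      then show "x \<alpha> * y (\<lambda>i. \<beta> i - \<alpha> i) = a \<alpha> * b (\<lambda>i. \<beta> i - \<alpha> i) * monomial \<beta> z"
        by (simp add: x_def y_def)
    qed simp
  qed
  finally show "((\<lambda>\<beta>. (\<Sum>\<alpha>\<in>{\<alpha>. \<forall>i. \<alpha> i \<le> \<beta> i}. a \<alpha> * b (\<lambda>i. \<beta> i - \<alpha> i)) * monomial \<beta> z)
      has_sum f z * g z) UNIV"
    by (simp add: B_def)
qed

lemma has_power_series_const: "has_power_series (\<lambda>z. c) (\<lambda>\<alpha>. if \<alpha> = (\<lambda>i. 0) then c else 0)"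
  unfolding has_power_series_def
proof
  fix z :: "complex ^ 'a" assume "z \<in> ball 0 1"
  show "((\<lambda>\<alpha>. (if \<alpha> = (\<lambda>i. 0) then c else 0) * monomial \<alpha> z) has_sum c) UNIV"
    by (rule has_sum_finite_neutralI[where B = "{\<lambda>i. 0}"]) auto
qed

lemma const_in_drury_arveson: "(\<lambda>z. c) \<in> drury_arveson"
  unfolding drury_arveson_iff[OF has_power_series_const]
  by (rule finite_nonzero_values_imp_summable_on) (auto intro: finite_subset[of _ "{\<lambda>i. 0}"])

lemma const_in_multipliers: "(\<lambda>z. 1) \<in> multipliers"
  by (simp add: multipliers_def)

lemma DA_norm_zero: "DA_norm (\<lambda>z :: complex ^ 'd::finite. 0) = 0"
proof -
  have "taylor_coeff (\<lambda>z :: complex ^ 'd. 0) = (\<lambda>\<alpha>. 0)" 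
    using taylor_coeff_eq[OF has_power_series_const[of 0]] by simp
  then show ?thesis by (simp add: DA_norm_def)
qed

lemma self_in_inv_subspace: "f \<in> drury_arveson \<Longrightarrow> f \<in> inv_subspace f"
  unfolding inv_subspace_def using const_in_multipliers by (auto intro!: bexI[of _ "\<lambda>z. 1"] simp: DA_norm_zero)

lemma multiplier_in_drury_arveson: "u \<in> multipliers \<Longrightarrow> u \<in> drury_arveson"
  using const_in_drury_arveson[of 1] unfolding multipliers_def by auto

section \<open>Composition with the normalised coordinate product\<close>

definition peak_const :: "'d set \<Rightarrow> real" where
  "peak_const J = real (card J) powr (real (card J) / 2)"

text \<open>
  This is \<open>tau e k\<close> for \<open>J = e ` {1..k}\<close>; it depends on the set of coordinates only, not on their order.
  It has modulus \<open>1\<close> where the coordinates in \<open>J\<close> have modulus \<open>k\<^bsup>-1/2\<^esup>\<close> and the others vanish.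
\<close>

definition peak :: "'d::finite set \<Rightarrow> complex ^ 'd \<Rightarrow> complex" where
  "peak J z = of_real (peak_const J) * (\<Prod>i\<in>J. z $ i)"

definition diag_index :: "'d set \<Rightarrow> nat \<Rightarrow> 'd \<Rightarrow> nat" where
  "diag_index J m = (\<lambda>i. if i \<in> J then m else 0)"

text \<open>
  The squared norm of \<open>peak J ^ m\<close> in the Drury-Arveson space, for \<open>k = card J\<close>.
\<close>

definition diag_weight :: "nat \<Rightarrow> nat \<Rightarrow> real" where
  "diag_weight k m = real k ^ (k * m) * fact m ^ k / fact (k * m)"

lemma peak_const_pos: 
  fixes J :: "'d::finite set"
  shows "J \<noteq> {} \<Longrightarrow> peak_const J > 0"
  by (simp add: peak_const_def card_gt_0_iff)

lemma peak_const_sq: 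
  fixes J :: "'d::finite set"
  shows "J \<noteq> {} \<Longrightarrow> (peak_const J)\<^sup>2 = real (card J) ^ card J"
  by (simp add: peak_const_def powr_power powr_realpow card_gt_0_iff)

lemma inj_diag_index: "J \<noteq> {} \<Longrightarrow> inj (diag_index J)"
  by (auto simp: inj_on_def diag_index_def fun_eq_iff split: if_splits)

lemma monomial_diag_index: 
  fixes J :: "'d::finite set"
  shows "monomial (diag_index J m) z = (\<Prod>i\<in>J. z $ i) ^ m"
  unfolding monomial_def diag_index_def prod_power_distrib
  by (rule prod.mono_neutral_cong_right) auto

text \<open>
  The inequality between the arithmetic and the geometric mean of the squares \<open>\<bar>z\<^sub>i\<bar>\<^sup>2\<close>.
\<close>

lemma norm_peak_le:
  fixes z :: "complex ^ 'd::finite"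
  assumes J: "J \<noteq> {}"
  shows "cmod (peak J z) \<le> norm z ^ card J"
proof (rule power2_le_imp_le)
  define k where "k = card J"
  have k: "k > 0" using J by (simp add: k_def card_gt_0_iff)
  define P where "P = (\<Prod>i\<in>J. (cmod (z $ i))\<^sup>2)"
  have P0: "P \<ge> 0" by (simp add: P_def prod_nonneg)
  have "P powr (1 / real k) \<le> (\<Sum>i\<in>J. (cmod (z $ i))\<^sup>2 / real k)"
    unfolding k_def P_def by (rule arith_geom_mean) (use J in auto)
  then have "(P powr (1 / real k)) ^ k \<le> ((\<Sum>i\<in>J. (cmod (z $ i))\<^sup>2) / real k) ^ k"
    by (intro power_mono) (auto simp: sum_divide_distrib)
  moreover have "(P powr (1 / real k)) ^ k = P"
    using P0 k by (cases "P = 0") (auto simp: powr_power)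
  ultimately have "real k ^ k * P \<le> (\<Sum>i\<in>J. (cmod (z $ i))\<^sup>2) ^ k"
    using k by (simp add: power_divide field_simps)
  also have "\<dots> \<le> ((norm z)\<^sup>2) ^ k"
  proof (intro power_mono sum_nonneg)
    have "(\<Sum>i\<in>J. (cmod (z $ i))\<^sup>2) \<le> (\<Sum>i\<in>UNIV. (cmod (z $ i))\<^sup>2)"
      by (rule sum_mono2) auto
    then show "(\<Sum>i\<in>J. (cmod (z $ i))\<^sup>2) \<le> (norm z)\<^sup>2"
      by (simp add: norm_vec_def L2_set_def real_sqrt_pow2 sum_nonneg)
  qed auto
  finally have "real k ^ k * P \<le> ((norm z)\<^sup>2) ^ k" .
  moreover have "(cmod (peak J z))\<^sup>2 = real k ^ k * P"
    using peak_const_sq[OF J] 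
    by (simp add: peak_def norm_mult power_mult_distrib P_def k_def prod_norm[symmetric] prod_power_distrib)
  ultimately show "(cmod (peak J z))\<^sup>2 \<le> (norm z ^ card J)\<^sup>2"
    by (simp add: k_def power_even_eq[symmetric] power_mult[symmetric] mult.commute)
qed simp

lemma peak_in_disc:
  fixes z :: "complex ^ 'd::finite"
  assumes "J \<noteq> {}" "z \<in> ball 0 1"
  shows "cmod (peak J z) < 1"
proof -
  have "cmod (peak J z) \<le> norm z ^ card J" by (rule norm_peak_le[OF assms(1)])
  also have "\<dots> < 1" using assms by (intro power_less_one_iff[THEN iffD2]) (auto simp: card_gt_0_iff)
  finally show ?thesis .
qed

text \<open>
  The Taylor coefficients of \<open>f \<circ> peak J\<close> when \<open>f\<close> has the coefficients \<open>f\<^sub>m\<close>: only the multi-indices that are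
  constant on \<open>J\<close> and zero elsewhere occur.
\<close>

definition diag_series :: "'d set \<Rightarrow> (nat \<Rightarrow> complex) \<Rightarrow> ('d \<Rightarrow> nat) \<Rightarrow> complex" where
  "diag_series J f \<alpha> =
     (if \<alpha> \<in> range (diag_index J)
      then f (inv (diag_index J) \<alpha>) * of_real (peak_const J) ^ inv (diag_index J) \<alpha> else 0)"

lemma diag_series_diag:
  "J \<noteq> {} \<Longrightarrow> diag_series J f (diag_index J m) = f m * of_real (peak_const J) ^ m"
  by (simp add: diag_series_def inv_f_f[OF inj_diag_index])

lemma diag_series_off: "\<alpha> \<notin> range (diag_index J) \<Longrightarrow> diag_series J f \<alpha> = 0"
  by (simp add: diag_series_def)

lemma power_series_has_sum:
  fixes f :: "nat \<Rightarrow> complex"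
  assumes "\<And>l. l \<in> ball 0 1 \<Longrightarrow> (\<lambda>m. f m * l ^ m) sums F l" and l: "cmod l < 1"
  shows "((\<lambda>m. f m * l ^ m) has_sum F l) UNIV"
proof (rule norm_summable_imp_has_sum)
  from l obtain r where r: "cmod l < r" "r < 1" using dense by blast
  then have "complex_of_real r \<in> ball 0 1" using norm_ge_zero[of l] by (simp del: norm_ge_zero)
  from sums_summable[OF assms(1)[OF this]]
  show "summable (\<lambda>m. cmod (f m * l ^ m))"
    by (rule powser_insidea) (use r norm_ge_zero[of l] in \<open>simp del: norm_ge_zero\<close>)
qed (use assms in auto)

lemma has_power_series_compose_peak:
  fixes J :: "'d::finite set"
  assumes J: "J \<noteq> {}" and F: "\<And>l. l \<in> ball 0 1 \<Longrightarrow> (\<lambda>m. f m * l ^ m) sums F l"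
  shows "has_power_series (\<lambda>z. F (peak J z)) (diag_series J f)"
  unfolding has_power_series_def
proof
  fix z :: "complex ^ 'd" assume "z \<in> ball 0 1"
  then have "cmod (peak J z) < 1" by (rule peak_in_disc[OF J])
  then have "((\<lambda>m. f m * peak J z ^ m) has_sum F (peak J z)) UNIV"
    by (rule power_series_has_sum[rotated]) (rule F)
  also have "(\<lambda>m. f m * peak J z ^ m)
      = (\<lambda>\<alpha>. diag_series J f \<alpha> * monomial \<alpha> z) \<circ> diag_index J"
    by (auto simp: fun_eq_iff diag_series_diag[OF J] monomial_diag_index peak_def power_mult_distrib)
  finally have "((\<lambda>\<alpha>. diag_series J f \<alpha> * monomial \<alpha> z) has_sum F (peak J z)) (range (diag_index J))"
    by (subst has_sum_reindex[OF inj_diag_index[OF J]])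
  then show "((\<lambda>\<alpha>. diag_series J f \<alpha> * monomial \<alpha> z) has_sum F (peak J z)) UNIV"
    by (subst has_sum_cong_neutral[where T = "range (diag_index J)" 
          and g = "\<lambda>\<alpha>. diag_series J f \<alpha> * monomial \<alpha> z"])
       (auto simp: diag_series_off)
qed

lemma power_swap: "((x :: real) ^ m) ^ n = (x ^ n) ^ m"
  by (simp only: power_mult[symmetric] mult.commute)

lemma DA_weight_diag_index:
  fixes J :: "'d::finite set"
  assumes J: "J \<noteq> {}"
  shows "DA_weight (diag_index J m) * (peak_const J ^ m)\<^sup>2 = diag_weight (card J) m"
proof -
  have "(\<Prod>i\<in>UNIV. fact (diag_index J m i)) = (\<Prod>i\<in>J. fact m :: real)"
    by (rule prod.mono_neutral_cong_right) (auto simp: diag_index_def)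
  moreover have "(\<Sum>i\<in>UNIV. diag_index J m i) = (\<Sum>i\<in>J. m)"
    by (rule sum.mono_neutral_cong_right) (auto simp: diag_index_def)
  moreover have "(peak_const J ^ m)\<^sup>2 = real (card J) ^ (card J * m)"
    by (subst power_swap) (simp only: peak_const_sq[OF J] power_mult)
  ultimately show ?thesis
    by (simp add: DA_weight_def diag_weight_def)
qed

lemma diag_coeff_weighted:
  fixes J :: "'d::finite set"
  assumes J: "J \<noteq> {}"
  shows "DA_weight (diag_index J m) * (cmod x)\<^sup>2
           = diag_weight (card J) m * (cmod (x / of_real (peak_const J) ^ m))\<^sup>2"
proof -
  have K: "peak_const J > 0" by (rule peak_const_pos[OF J])
  then have "(cmod (x / of_real (peak_const J) ^ m))\<^sup>2 = (cmod x)\<^sup>2 / (peak_const J ^ m)\<^sup>2"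
    by (simp add: norm_divide norm_power power_divide)
  with K show ?thesis unfolding DA_weight_diag_index[OF J, symmetric] by simp
qed

lemma drury_arveson_compose_peak:
  fixes J :: "'d::finite set"
  assumes J: "J \<noteq> {}" and F: "\<And>l. l \<in> ball 0 1 \<Longrightarrow> (\<lambda>m. f m * l ^ m) sums F l"
    and fin: "summable (\<lambda>m. diag_weight (card J) m * (cmod (f m))\<^sup>2)"
  shows "(\<lambda>z. F (peak J z)) \<in> drury_arveson"
proof -
  let ?h = "\<lambda>\<alpha>. DA_weight \<alpha> * (cmod (diag_series J f \<alpha>))\<^sup>2"
  have eq: "?h \<circ> diag_index J = (\<lambda>m. diag_weight (card J) m * (cmod (f m))\<^sup>2)"
    using peak_const_pos[OF J]
    by (auto simp: fun_eq_iff diag_coeff_weighted[OF J] diag_series_diag[OF J])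
  have "(\<lambda>m. diag_weight (card J) m * (cmod (f m))\<^sup>2) summable_on UNIV"
    by (rule norm_summable_imp_summable_on) (use fin in \<open>simp add: diag_weight_def abs_mult\<close>)
  then have "?h summable_on range (diag_index J)"
    by (subst summable_on_reindex[OF inj_diag_index[OF J]]) (simp only: eq)
  then have "?h summable_on UNIV"
    by (subst summable_on_cong_neutral[where T = "range (diag_index J)" and g = ?h])
       (auto simp: diag_series_off)
  then show ?thesis by (subst drury_arveson_iff[OF has_power_series_compose_peak[OF J F]])
qed

text \<open>
  By orthogonality of the monomials, the diagonal multi-indices carry a part of the norm of \<open>F\<close>.
\<close>

lemma diag_coeffs_bound:
  fixes J :: "'d::finite set"
  assumes J: "J \<noteq> {}" and F: "F \<in> drury_arveson" and a: "has_power_series F a"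
  defines "c \<equiv> \<lambda>m. a (diag_index J m) / of_real (peak_const J) ^ m"
  shows "summable (\<lambda>m. diag_weight (card J) m * (cmod (c m))\<^sup>2)"
    and "(\<Sum>m. diag_weight (card J) m * (cmod (c m))\<^sup>2) \<le> (DA_norm F)\<^sup>2"
proof -
  let ?h = "\<lambda>\<alpha>. DA_weight \<alpha> * (cmod (a \<alpha>))\<^sup>2"
  have h: "?h summable_on UNIV" using F drury_arveson_iff[OF a] by simp
  then have hr: "?h summable_on range (diag_index J)" by (rule summable_on_subset_banach) simp
  have eq: "?h \<circ> diag_index J = (\<lambda>m. diag_weight (card J) m * (cmod (c m))\<^sup>2)"
    by (auto simp: fun_eq_iff diag_coeff_weighted[OF J] c_def)
  have "(?h has_sum infsum ?h (range (diag_index J))) (range (diag_index J))"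
    using hr by simp
  then have "((\<lambda>m. diag_weight (card J) m * (cmod (c m))\<^sup>2) has_sum infsum ?h (range (diag_index J))) UNIV"
    by (subst (asm) has_sum_reindex[OF inj_diag_index[OF J]]) (simp only: eq)
  from has_sum_imp_sums[OF this]
  have s: "(\<lambda>m. diag_weight (card J) m * (cmod (c m))\<^sup>2) sums infsum ?h (range (diag_index J))" .
  then show "summable (\<lambda>m. diag_weight (card J) m * (cmod (c m))\<^sup>2)" by (rule sums_summable)
  have "infsum ?h (range (diag_index J)) \<le> infsum ?h UNIV"
    by (rule infsum_mono2[OF hr h]) (auto simp: DA_weight_nonneg)
  also have "\<dots> = (DA_norm F)\<^sup>2"
    unfolding DA_norm_def taylor_coeff_eq[OF a]
    by (simp add: infsum_nonneg DA_weight_nonneg)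
  finally show "(\<Sum>m. diag_weight (card J) m * (cmod (c m))\<^sup>2) \<le> (DA_norm F)\<^sup>2"
    using sums_unique[OF s] by simp
qed

text \<open>
  Subtracting a diagonal multi-index from a diagonal one leaves a diagonal one, so the diagonal coefficients
  of \<open>u (f \<circ> peak J)\<close> involve only those of \<open>u\<close>.
\<close>

lemma diag_coeff_mult:
  fixes J :: "'d::finite set"
  assumes J: "J \<noteq> {}" and F: "\<And>l. l \<in> ball 0 1 \<Longrightarrow> (\<lambda>m. f m * l ^ m) sums F l"
    and u: "has_power_series u a"
  obtains b where "has_power_series (\<lambda>z. u z * F (peak J z)) b"
    and "\<And>m. b (diag_index J m) / of_real (peak_const J) ^ m
          = (\<Sum>i\<le>m. f i * (a (diag_index J (m - i)) / of_real (peak_const J) ^ (m - i)))"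
proof
  let ?K = "complex_of_real (peak_const J)"
  let ?b = "\<lambda>\<beta>. \<Sum>\<alpha>\<in>{\<alpha>. \<forall>i. \<alpha> i \<le> \<beta> i}. diag_series J f \<alpha> * a (\<lambda>i. \<beta> i - \<alpha> i)"
  show "has_power_series (\<lambda>z. u z * F (peak J z)) ?b"
    using has_power_series_mult[OF has_power_series_compose_peak[OF J F] u]
    by (simp add: mult.commute[of "u _"])
  fix m
  have inj: "inj_on (diag_index J) {..m}" using inj_diag_index[OF J] by (rule inj_on_subset) simp
  obtain i0 where i0: "i0 \<in> J" using J by auto
  have "?b (diag_index J m)
      = (\<Sum>\<alpha>\<in>diag_index J ` {..m}. diag_series J f \<alpha> * a (\<lambda>i. diag_index J m i - \<alpha> i))"
  proof (rule sum.mono_neutral_right[OF finite_bounded_indices])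
    show "diag_index J ` {..m} \<subseteq> {\<alpha>. \<forall>i. \<alpha> i \<le> diag_index J m i}"
      by (auto simp: diag_index_def)
    show "\<forall>\<alpha>\<in>{\<alpha>. \<forall>i. \<alpha> i \<le> diag_index J m i} - diag_index J ` {..m}.
        diag_series J f \<alpha> * a (\<lambda>i. diag_index J m i - \<alpha> i) = 0"
    proof
      fix \<alpha> assume \<alpha>: "\<alpha> \<in> {\<alpha>. \<forall>i. \<alpha> i \<le> diag_index J m i} - diag_index J ` {..m}"
      have "\<alpha> \<notin> range (diag_index J)"
      proof
        assume "\<alpha> \<in> range (diag_index J)"
        then obtain n where n: "\<alpha> = diag_index J n" by auto
        with \<alpha> have "diag_index J n i0 \<le> diag_index J m i0" by blast
        with i0 have "n \<le> m" by (simp add: diag_index_def)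
        with n \<alpha> show False by auto
      qed
      then show "diag_series J f \<alpha> * a (\<lambda>i. diag_index J m i - \<alpha> i) = 0"
        by (simp add: diag_series_off)
    qed
  qed
  also have "\<dots> = (\<Sum>i\<le>m. diag_series J f (diag_index J i) * a (\<lambda>j. diag_index J m j - diag_index J i j))"
    by (subst sum.reindex[OF inj]) simp
  also have "\<dots> = (\<Sum>i\<le>m. f i * ?K ^ i * a (diag_index J (m - i)))"
  proof (intro sum.cong refl)
    fix i
    have "(\<lambda>j. diag_index J m j - diag_index J i j) = diag_index J (m - i)"
      by (auto simp: diag_index_def)
    then show "diag_series J f (diag_index J i) * a (\<lambda>j. diag_index J m j - diag_index J i j)
        = f i * ?K ^ i * a (diag_index J (m - i))"
      by (simp add: diag_series_diag[OF J])
  qed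
  finally have "?b (diag_index J m) = (\<Sum>i\<le>m. f i * ?K ^ i * a (diag_index J (m - i)))" .
  moreover have "f i * ?K ^ i * x / ?K ^ m = f i * (x / ?K ^ (m - i))" if "i \<le> m" for i x
    using that peak_const_pos[OF J] by (simp add: field_simps flip: power_add)
  ultimately show "?b (diag_index J m) / ?K ^ m = (\<Sum>i\<le>m. f i * (a (diag_index J (m - i)) / ?K ^ (m - i)))"
    by (simp add: sum_divide_distrib)
qed

section \<open>Growth of the norms of the powers of the coordinate product\<close>

lemma fact_add_prod: "fact (n + k) = fact n * (\<Prod>i=1..k. real n + real i)"
  by (induction k) (auto simp: algebra_simps)

text \<open>
  Pair the factor for \<open>i\<close> with the factor for \<open>k - i\<close>: the product of the two is at most the square of
  their mean.
\<close>

lemma prod_le_midpoint_power: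
  assumes k: "k \<ge> 1" and x: "x \<ge> 0"
  shows "(\<Prod>i=1..k-1. x + real i) \<le> (x + real k / 2) ^ (k - 1)"
proof (rule power2_le_imp_le)
  have "(\<Prod>i=1..k-1. x + real i)\<^sup>2 = (\<Prod>i=1..k-1. x + real i) * (\<Prod>i=1..k-1. x + real (k - i))"
  proof -
    have "(\<Prod>i=1..k-1. x + real i) = (\<Prod>i=1..k-1. x + real (k - i))"
      by (rule prod.reindex_bij_witness[where i = "\<lambda>i. k - i" and j = "\<lambda>i. k - i"]) auto
    then show ?thesis by (simp add: power2_eq_square)
  qed
  also have "\<dots> = (\<Prod>i=1..k-1. (x + real i) * (x + real (k - i)))" by (simp add: prod.distrib)
  also have "\<dots> \<le> (\<Prod>i=1..k-1. (x + real k / 2)\<^sup>2)"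
  proof (rule prod_mono, intro conjI)
    fix i assume i: "i \<in> {1..k-1}"
    show "0 \<le> (x + real i) * (x + real (k - i))" using x by simp
    have "0 \<le> (real i - real k / 2)\<^sup>2" by simp
    then show "(x + real i) * (x + real (k - i)) \<le> (x + real k / 2)\<^sup>2"
      using i by (subst of_nat_diff) (auto simp: power2_eq_square algebra_simps)
  qed
  also have "\<dots> = ((x + real k / 2) ^ (k - 1))\<^sup>2"
    by (simp add: power_mult[symmetric] mult.commute)
  finally show "(\<Prod>i=1..k-1. x + real i)\<^sup>2 \<le> ((x + real k / 2) ^ (k - 1))\<^sup>2" .
qed (use x in simp)

lemma diag_weight_Suc:
  assumes k: "k \<ge> 1"
  shows "diag_weight k (Suc m) * (\<Prod>i=1..k-1. real (k * m) + real i)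
           = diag_weight k m * (real k * (real m + 1)) ^ (k - 1)"
proof -
  define P where "P = (\<Prod>i=1..k-1. real (k * m) + real i)"
  have P: "P > 0" unfolding P_def by (rule prod_pos) (auto intro!: add_nonneg_pos)
  obtain j where j: "k = Suc j" using k by (cases k) auto
  have "fact (k * Suc m) = fact (k * m) * (P * (real k * (real m + 1)))"
    using fact_add_prod[of "k * m" k] by (simp add: P_def j algebra_simps)
  then have "diag_weight k (Suc m) 
      = real k ^ (k * m) * real k ^ k * ((real m + 1) * fact m) ^ k / (fact (k * m) * (P * (real k * (real m + 1))))"
    by (simp add: diag_weight_def power_add add.commute mult.commute)
  also have "\<dots> = diag_weight k m * (real k * (real m + 1)) ^ k / (P * (real k * (real m + 1)))"
    by (simp add: diag_weight_def power_mult_distrib)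
  also have "\<dots> = diag_weight k m * (real k * (real m + 1)) ^ (k - 1) / P"
    using k by (simp add: j)
  finally show ?thesis using P unfolding P_def[symmetric] by simp
qed

lemma ratio_le_square:
  fixes x y z :: real
  assumes "y\<^sup>2 * z \<le> x ^ 3" "x > 0" "y > 0"
  shows "z / x \<le> (x / y)\<^sup>2"
  proof -
  have "z * y\<^sup>2 \<le> x\<^sup>2 * x"
    using assms(1) by (simp only: power2_eq_square power3_eq_cube mult.commute mult.assoc)
  then have "z \<le> (x\<^sup>2 / y\<^sup>2) * x"
    using assms(3) by (simp only: times_divide_eq_left pos_le_divide_eq zero_less_power)
  then show ?thesis using assms(2) by (simp only: power_divide pos_divide_le_eq)
qed

lemma cross_multiply:
  fixes a b c d :: real
  assumes "a / b \<le> c / d" "b > 0" "d > 0"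
  shows "a * d \<le> b * c"
  using assms by (simp add: pos_divide_le_eq pos_le_divide_eq mult.commute)

text \<open>
  The quotient of consecutive weights is \<open>(k (m + 1))\<^bsup>k-1\<^esup>\<close> over the product of the \<open>k m + i\<close> with \<open>0 < i < k\<close>.
  By the midpoint bound it is at least \<open>((m + 1) / (m + 1/2))\<^bsup>k-1\<^esup>\<close>, and
  \<open>((m + 1) / (m + 1/2))\<^sup>2 \<ge> (m + 2) / (m + 1)\<close>.
\<close>

lemma diag_weight_ge:
  assumes k: "k \<ge> 1"
  shows "diag_weight k m \<ge> (real m + 1) powr ((real k - 1) / 2)"
proof (induction m)
  case 0
  then show ?case by (simp add: diag_weight_def)
next
  case (Suc m)
  define P where "P = (\<Prod>i=1..k-1. real (k * m) + real i)"
  define s where "s = (real k - 1) / 2"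
  have P: "P > 0" unfolding P_def by (rule prod_pos) (auto intro!: add_nonneg_pos)
  have "(real m + 1/2)\<^sup>2 * (real m + 2) \<le> (real m + 1) ^ 3"
    by (simp add: power2_eq_square power3_eq_cube algebra_simps)
  then have "(real m + 2) / (real m + 1) \<le> ((real m + 1) / (real m + 1/2))\<^sup>2"
    by (rule ratio_le_square) simp_all
  then have "((real m + 2) / (real m + 1)) powr s \<le> (((real m + 1) / (real m + 1/2))\<^sup>2) powr s"
    by (intro powr_mono2) (use k in \<open>auto simp: s_def\<close>)
  also have "\<dots> = ((real m + 1) / (real m + 1/2)) ^ (k - 1)"
  proof -
    have x: "(real m + 1) / (real m + 1/2) > 0" by (rule divide_pos_pos) simp_all
    have "((real m + 1) / (real m + 1/2))\<^sup>2 = ((real m + 1) / (real m + 1/2)) powr 2"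
      using x by (simp only: powr_numeral)
    moreover have "2 * s = real (k - 1)" using k by (simp add: s_def of_nat_diff)
    ultimately show ?thesis using x by (simp only: powr_powr powr_realpow)
  qed
  finally have "(real m + 2) powr s / (real m + 1) powr s \<le> (real m + 1) ^ (k - 1) / (real m + 1/2) ^ (k - 1)"
    by (simp only: powr_divide power_divide)
  then have "(real m + 2) powr s * (real m + 1/2) ^ (k - 1) \<le> (real m + 1) powr s * (real m + 1) ^ (k - 1)"
    by (rule cross_multiply) simp_all
  then have "((real m + 2) powr s * (real m + 1/2) ^ (k - 1)) * real k ^ (k - 1) 
      \<le> ((real m + 1) powr s * (real m + 1) ^ (k - 1)) * real k ^ (k - 1)"
    by (rule mult_right_mono) simp
  then have 1: "(real m + 2) powr s * (real k * (real m + 1/2)) ^ (k - 1) 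
      \<le> (real m + 1) powr s * (real k * (real m + 1)) ^ (k - 1)"
    by (simp add: power_mult_distrib mult_ac)
  have "P \<le> (real (k * m) + real k / 2) ^ (k - 1)"
    unfolding P_def by (rule prod_le_midpoint_power) (use k in auto)
  moreover have "real (k * m) + real k / 2 = real k * (real m + 1/2)" by (simp add: algebra_simps)
  ultimately have "P \<le> (real k * (real m + 1/2)) ^ (k - 1)" by (simp only:)
  then have "(real m + 2) powr s * P \<le> (real m + 2) powr s * (real k * (real m + 1/2)) ^ (k - 1)"
    by (rule mult_left_mono) simp
  also note 1
  also have "(real m + 1) powr s * (real k * (real m + 1)) ^ (k - 1) 
     \<le> diag_weight k m * (real k * (real m + 1)) ^ (k - 1)"
    using Suc by (intro mult_right_mono) (auto simp: s_def)
  also have "\<dots> = diag_weight k (Suc m) * P"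
    unfolding P_def by (rule diag_weight_Suc[OF k, symmetric])
  finally show ?case using P by (simp add: s_def add.commute)
qed

section \<open>Functionals that annihilate an invariant subspace\<close>

lemma Cauchy_Schwarz_suminf:
  fixes a b :: "nat \<Rightarrow> real"
  assumes "\<And>n. a n \<ge> 0" "\<And>n. b n \<ge> 0"
    and sa: "summable (\<lambda>n. (a n)\<^sup>2)" and sb: "summable (\<lambda>n. (b n)\<^sup>2)"
  shows "summable (\<lambda>n. a n * b n)"
    and "(\<Sum>n. a n * b n) \<le> sqrt (\<Sum>n. (a n)\<^sup>2) * sqrt (\<Sum>n. (b n)\<^sup>2)"
proof -
  have bnd: "(\<Sum>i<n. a i * b i) \<le> sqrt (\<Sum>n. (a n)\<^sup>2) * sqrt (\<Sum>n. (b n)\<^sup>2)" for n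
  proof -
    have "(\<Sum>i<n. a i * b i) = (\<Sum>i<n. \<bar>a i\<bar> * \<bar>b i\<bar>)" using assms by simp
    also have "\<dots> \<le> L2_set a {..<n} * L2_set b {..<n}" by (rule L2_set_mult_ineq)
    also have "\<dots> \<le> sqrt (\<Sum>n. (a n)\<^sup>2) * sqrt (\<Sum>n. (b n)\<^sup>2)"
      unfolding L2_set_def using sa sb
      by (intro mult_mono) (auto intro!: sum_le_suminf suminf_nonneg sum_nonneg)
    finally show ?thesis .
  qed
  show s: "summable (\<lambda>n. a n * b n)"
    by (rule summableI_nonneg_bounded[OF _ bnd]) (use assms in auto)
  show "(\<Sum>n. a n * b n) \<le> sqrt (\<Sum>n. (a n)\<^sup>2) * sqrt (\<Sum>n. (b n)\<^sup>2)"
    by (rule suminf_le_const[OF s]) (use bnd in auto)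
qed

text \<open>
  The claim is \<open>\<Sum>\<^sub>j g\<^sub>j (\<Sum>\<^sub>i f\<^sub>i \<nu>\<^sub>i\<^sub>+\<^sub>j) = 0\<close> with the double sum arranged by \<open>m = i + j\<close>.  The hypotheses on the
  weight serve the absolute convergence: \<open>\<bar>\<nu>\<^sub>i\<^sub>+\<^sub>j\<bar> \<le> p\<^sub>i p\<^sub>j \<bar>\<nu>\<^sub>i\<^sub>+\<^sub>j\<bar> / p\<^sub>i\<^sub>+\<^sub>j\<close>, after which the sum over \<open>j\<close> is bounded
  by the Cauchy-Schwarz inequality, uniformly in \<open>i\<close>.
\<close>

lemma Hankel_annihilation:
  fixes f g \<nu> :: "nat \<Rightarrow> complex" and p :: "nat \<Rightarrow> real"
  assumes p: "\<And>m. p m > 0" and sub: "\<And>i j. p (i + j) \<le> p i * p j"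
    and f: "summable (\<lambda>i. cmod (f i) * p i)"
    and g: "summable (\<lambda>j. (cmod (g j) * p j)\<^sup>2)"
    and \<nu>: "summable (\<lambda>m. (cmod (\<nu> m) / p m)\<^sup>2)"
    and ann: "\<And>j. (\<lambda>i. f i * \<nu> (i + j)) sums 0"
  shows "(\<lambda>m. \<nu> m * (\<Sum>i\<le>m. f i * g (m - i))) sums 0"
proof -
  define q where "q = (\<lambda>(i, j). f i * g j * \<nu> (i + j))"
  define C where "C = sqrt (\<Sum>j. (cmod (g j) * p j)\<^sup>2) * sqrt (\<Sum>m. (cmod (\<nu> m) / p m)\<^sup>2)"
  have row: "summable (\<lambda>j. cmod (q (i, j)))" "(\<Sum>j. cmod (q (i, j))) \<le> cmod (f i) * p i * C" for i
  proof -
    have sh: "summable (\<lambda>j. (cmod (\<nu> (i + j)) / p (i + j))\<^sup>2)"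
      using summable_iff_shift[of "\<lambda>m. (cmod (\<nu> m) / p m)\<^sup>2" i] \<nu> by (simp add: add.commute)
    have cs: "summable (\<lambda>j. (cmod (g j) * p j) * (cmod (\<nu> (i + j)) / p (i + j)))"
      "(\<Sum>j. (cmod (g j) * p j) * (cmod (\<nu> (i + j)) / p (i + j))) 
        \<le> sqrt (\<Sum>j. (cmod (g j) * p j)\<^sup>2) * sqrt (\<Sum>j. (cmod (\<nu> (i + j)) / p (i + j))\<^sup>2)"
      using p by (intro Cauchy_Schwarz_suminf g sh; simp add: less_imp_le)+
    have "(\<Sum>j. (cmod (\<nu> (i + j)) / p (i + j))\<^sup>2) \<le> (\<Sum>m. (cmod (\<nu> m) / p m)\<^sup>2)"
    proof -
      have "(\<Sum>m. (cmod (\<nu> m) / p m)\<^sup>2) 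
          = (\<Sum>j. (cmod (\<nu> (j + i)) / p (j + i))\<^sup>2) + (\<Sum>m<i. (cmod (\<nu> m) / p m)\<^sup>2)"
        by (rule suminf_split_initial_segment[OF \<nu>])
      moreover have "(\<Sum>m<i. (cmod (\<nu> m) / p m)\<^sup>2) \<ge> 0" by (rule sum_nonneg) simp
      ultimately show ?thesis by (simp add: add.commute)
    qed
    then have "sqrt (\<Sum>j. (cmod (g j) * p j)\<^sup>2) * sqrt (\<Sum>j. (cmod (\<nu> (i + j)) / p (i + j))\<^sup>2) \<le> C"
      unfolding C_def using g by (intro mult_left_mono) (auto intro: suminf_nonneg)
    with cs(2) have cs2: "(\<Sum>j. (cmod (g j) * p j) * (cmod (\<nu> (i + j)) / p (i + j))) \<le> C" by simp
    have le: "cmod (q (i, j)) \<le> cmod (f i) * p i * ((cmod (g j) * p j) * (cmod (\<nu> (i + j)) / p (i + j)))" for j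
    proof -
      have "cmod (q (i, j)) = cmod (f i) * cmod (g j) * (cmod (\<nu> (i + j)) / p (i + j)) * p (i + j)"
        using p[of "i + j"] by (simp add: q_def norm_mult)
      also have "\<dots> \<le> cmod (f i) * cmod (g j) * (cmod (\<nu> (i + j)) / p (i + j)) * (p i * p j)"
        using p[of "i + j"] by (intro mult_left_mono sub) simp
      finally show ?thesis by (simp add: mult_ac)
    qed
    show s: "summable (\<lambda>j. cmod (q (i, j)))"
      by (rule summable_comparison_test'[OF summable_mult[OF cs(1), of "cmod (f i) * p i"]])
         (use le in simp)
    have "(\<Sum>j. cmod (q (i, j))) \<le> cmod (f i) * p i * (\<Sum>j. (cmod (g j) * p j) * (cmod (\<nu> (i + j)) / p (i + j)))"
      unfolding suminf_mult[OF cs(1), symmetric]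
      by (intro suminf_le le s summable_mult cs(1))
    also have "\<dots> \<le> cmod (f i) * p i * C"
      using cs2 p[of i] by (intro mult_left_mono) auto
    finally show "(\<Sum>j. cmod (q (i, j))) \<le> cmod (f i) * p i * C" .
  qed
  have "(\<lambda>x. norm (q x)) summable_on UNIV \<times> UNIV"
  proof (rule summable_on_SigmaI)
    show "((\<lambda>j. norm (q (i, j))) has_sum (\<Sum>j. cmod (q (i, j)))) UNIV" for i
      using row(1)[of i] by (intro norm_summable_imp_has_sum) auto
    have nn: "(\<Sum>j. cmod (q (i, j))) \<ge> 0" for i by (intro suminf_nonneg row) auto
    have "summable (\<lambda>i. cmod (f i) * p i * C)" using f by (rule summable_mult2)
    then have "summable (\<lambda>i. \<Sum>j. cmod (q (i, j)))"
      by (rule summable_comparison_test'[where N = 0]) (use row nn in simp)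
    then show "(\<lambda>i. \<Sum>j. cmod (q (i, j))) summable_on UNIV"
      by (intro norm_summable_imp_summable_on) (use nn in simp)
  qed auto
  then have "q summable_on UNIV \<times> UNIV" by (rule abs_summable_summable)
  then obtain S where S: "(q has_sum S) (UNIV \<times> UNIV)" by (auto simp: summable_on_def)
  \<comment> \<open>Summing over \<open>i\<close> first, every inner sum vanishes by hypothesis.\<close>
  have "((\<lambda>(j, i). q (i, j)) has_sum S) (UNIV \<times> UNIV)"
    using S by (subst (asm) has_sum_reindex_bij_witness[where T = "UNIV \<times> UNIV" and i = prod.swap and j = prod.swap
          and h = "\<lambda>(j, i). q (i, j)" and s' = S]) auto
  then have sw: "((\<lambda>(j, i). q (i, j)) has_sum S) (Sigma UNIV (\<lambda>_. UNIV))" by simp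
  have "((\<lambda>j. 0) has_sum S) (UNIV :: nat set)"
  proof (rule has_sum_SigmaD[OF sw])
    fix j :: nat
    have "(\<lambda>i. q (i, j)) summable_on UNIV"
      using summable_on_SigmaD1[of "\<lambda>j i. q (i, j)" UNIV "\<lambda>_. UNIV" j] sw
      by (auto simp: summable_on_def)
    then have "((\<lambda>i. q (i, j)) has_sum (\<Sum>\<^sub>\<infinity>i. q (i, j))) UNIV" by simp
    moreover from has_sum_imp_sums[OF this] have "(\<Sum>\<^sub>\<infinity>i. q (i, j)) = 0"
      using sums_mult[OF ann[of j], of "g j"] sums_unique2 by (auto simp: q_def mult_ac)
    ultimately show "((\<lambda>i. case (j, i) of (j, i) \<Rightarrow> q (i, j)) has_sum 0) UNIV" by simp
  qed
  then have "S = 0" using has_sum_unique has_sum_0_simp by blast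
  with S have "(q has_sum 0) (UNIV \<times> UNIV)" by simp
  also have "(q has_sum 0) (UNIV \<times> UNIV) 
      \<longleftrightarrow> ((\<lambda>(m, i). f i * g (m - i) * \<nu> m) has_sum 0) (Sigma UNIV (\<lambda>m. {..m}))"
    by (rule has_sum_reindex_bij_witness[where j = "\<lambda>(i, j). (i + j, i)" and i = "\<lambda>(m, i). (i, m - i)"])
       (auto simp: q_def)
  finally have "((\<lambda>m. \<Sum>i\<le>m. f i * g (m - i) * \<nu> m) has_sum 0) UNIV"
    by (rule has_sum_SigmaD) (auto intro!: has_sum_finite)
  from has_sum_imp_sums[OF this] show ?thesis
    by (simp add: sum_distrib_left mult_ac)
qed

text \<open>
  The functional with coefficients \<open>\<nu>\<close> is bounded, vanishes on all \<open>u (F \<circ> peak J)\<close>, and takes the value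
  \<open>L \<noteq> 0\<close> at \<open>G \<circ> peak J\<close>, so the latter has positive distance to the former.  The exponent
  \<open>(card J - 1) / 4\<close> is half of the exponent in \<open>diag_weight_ge\<close>, since \<open>p\<close> enters squared.
\<close>

lemma not_in_inv_subspace:
  fixes J :: "'d::finite set" and f g \<nu> :: "nat \<Rightarrow> complex"
  assumes J: "J \<noteq> {}"
  defines "p \<equiv> \<lambda>m. (real m + 1) powr ((real (card J) - 1) / 4)"
  assumes F: "\<And>l. l \<in> ball 0 1 \<Longrightarrow> (\<lambda>m. f m * l ^ m) sums F l"
    and G: "\<And>l. l \<in> ball 0 1 \<Longrightarrow> (\<lambda>m. g m * l ^ m) sums G l"
    and FDA: "(\<lambda>z. F (peak J z)) \<in> drury_arveson" and GDA: "(\<lambda>z. G (peak J z)) \<in> drury_arveson"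
    and f: "summable (\<lambda>i. cmod (f i) * p i)"
    and \<nu>: "summable (\<lambda>m. (cmod (\<nu> m) / p m)\<^sup>2)"
    and ann: "\<And>j. (\<lambda>i. f i * \<nu> (i + j)) sums 0"
    and g: "(\<lambda>m. \<nu> m * g m) sums L" and L: "L \<noteq> 0"
  shows "(\<lambda>z. G (peak J z)) \<notin> inv_subspace (\<lambda>z. F (peak J z))"
proof
  let ?K = "complex_of_real (peak_const J)"
  have k: "card J \<ge> 1" using J by (simp add: card_gt_0_iff Suc_le_eq)
  have p: "p m > 0" for m by (simp add: p_def)
  have sub: "p (i + j) \<le> p i * p j" for i j
  proof -
    have "real (i + j) + 1 \<le> (real i + 1) * (real j + 1)" by (simp add: algebra_simps)
    then have "p (i + j) \<le> ((real i + 1) * (real j + 1)) powr ((real (card J) - 1) / 4)"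
      unfolding p_def using k by (intro powr_mono2) auto
    then show ?thesis by (simp add: p_def powr_mult)
  qed
  have pw: "(p m)\<^sup>2 \<le> diag_weight (card J) m" for m
  proof -
    have "(real (card J) - 1) / 4 + (real (card J) - 1) / 4 = (real (card J) - 1) / 2" by simp
    then have "(p m)\<^sup>2 = (real m + 1) powr ((real (card J) - 1) / 2)"
      by (simp only: p_def power2_eq_square powr_add[symmetric])
    then show ?thesis using diag_weight_ge[OF k, of m] by simp
  qed
  define N where "N = sqrt (\<Sum>m. (cmod (\<nu> m) / p m)\<^sup>2)"
  have N: "N \<ge> 0" unfolding N_def by (simp add: suminf_nonneg \<nu>)
  have weighted: "summable (\<lambda>m. (cmod (a (diag_index J m) / ?K ^ m) * p m)\<^sup>2)"
      "(\<Sum>m. (cmod (a (diag_index J m) / ?K ^ m) * p m)\<^sup>2) \<le> (DA_norm H)\<^sup>2"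
    if H: "H \<in> drury_arveson" "has_power_series H a" for H a
  proof -
    have le: "(cmod (a (diag_index J m) / ?K ^ m) * p m)\<^sup>2 
        \<le> diag_weight (card J) m * (cmod (a (diag_index J m) / ?K ^ m))\<^sup>2" for m
      using mult_right_mono[OF pw, of "(cmod (a (diag_index J m) / ?K ^ m))\<^sup>2" m]
      by (simp add: power_mult_distrib mult.commute)
    show s: "summable (\<lambda>m. (cmod (a (diag_index J m) / ?K ^ m) * p m)\<^sup>2)"
      by (rule summable_comparison_test'[OF diag_coeffs_bound(1)[OF J H]]) (use le in simp)
    show "(\<Sum>m. (cmod (a (diag_index J m) / ?K ^ m) * p m)\<^sup>2) \<le> (DA_norm H)\<^sup>2"
      using suminf_le[OF le s diag_coeffs_bound(1)[OF J H]] diag_coeffs_bound(2)[OF J H] by simp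
  qed
  assume "(\<lambda>z. G (peak J z)) \<in> inv_subspace (\<lambda>z. F (peak J z))"
  moreover have "cmod L / (N + 1) > 0" using L N by simp
  ultimately obtain u where u: "u \<in> multipliers" 
    and small: "DA_norm (\<lambda>z. u z * F (peak J z) - G (peak J z)) < cmod L / (N + 1)"
    unfolding inv_subspace_def by blast
  have uDA: "u \<in> drury_arveson" by (rule multiplier_in_drury_arveson[OF u])
  then obtain a where a: "has_power_series u a" by (rule drury_arveson_power_series)
  obtain b where b: "has_power_series (\<lambda>z. u z * F (peak J z)) b"
    and bc: "\<And>m. b (diag_index J m) / ?K ^ m
          = (\<Sum>i\<le>m. f i * (a (diag_index J (m - i)) / ?K ^ (m - i)))"
    using diag_coeff_mult[OF J F a] by blast
  define H where "H = (\<lambda>z. u z * F (peak J z) - G (peak J z))"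
  define h where "h = (\<lambda>\<alpha>. b \<alpha> - diag_series J g \<alpha>)"
  define c where "c m = h (diag_index J m) / ?K ^ m" for m
  have H: "has_power_series H h" unfolding H_def h_def
    by (rule has_power_series_diff[OF b has_power_series_compose_peak[OF J G]])
  have HDA: "H \<in> drury_arveson" unfolding H_def
    using u FDA by (intro drury_arveson_diff GDA) (auto simp: multipliers_def)
  have c: "c m = (\<Sum>i\<le>m. f i * (a (diag_index J (m - i)) / ?K ^ (m - i))) - g m" for m
    using bc[of m] peak_const_pos[OF J] by (simp add: c_def h_def diag_series_diag[OF J] diff_divide_distrib)
  have "(\<lambda>m. \<nu> m * (\<Sum>i\<le>m. f i * (a (diag_index J (m - i)) / ?K ^ (m - i)))) sums 0"
    by (rule Hankel_annihilation[OF p sub f weighted(1)[OF uDA a] \<nu> ann])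
  from sums_diff[OF this g] have "(\<lambda>m. \<nu> m * c m) sums - L"
    by (simp add: c right_diff_distrib)
  then have Leq: "cmod L = cmod (\<Sum>m. \<nu> m * c m)" by (simp add: sums_iff)
  have cs: "summable (\<lambda>m. (cmod (\<nu> m) / p m) * (cmod (c m) * p m))"
    "(\<Sum>m. (cmod (\<nu> m) / p m) * (cmod (c m) * p m)) \<le> N * sqrt (\<Sum>m. (cmod (c m) * p m)\<^sup>2)"
    unfolding N_def using p weighted(1)[OF HDA H] 
    by (intro Cauchy_Schwarz_suminf \<nu>; simp add: less_imp_le c_def)+
  have eq: "(cmod (\<nu> m) / p m) * (cmod (c m) * p m) = cmod (\<nu> m * c m)" for m
    using p[of m] by (simp add: norm_mult)
  have "cmod L \<le> (\<Sum>m. cmod (\<nu> m * c m))"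
    unfolding Leq using cs(1) unfolding eq by (rule summable_norm)
  also have "\<dots> \<le> N * sqrt (\<Sum>m. (cmod (c m) * p m)\<^sup>2)" using cs(2) unfolding eq .
  also have "\<dots> \<le> N * DA_norm H"
  proof (intro mult_left_mono N real_le_lsqrt)
    show "DA_norm H \<ge> 0" unfolding DA_norm_def by (simp add: infsum_nonneg DA_weight_nonneg)
    show "(\<Sum>m. (cmod (c m) * p m)\<^sup>2) \<le> (DA_norm H)\<^sup>2"
      unfolding c_def by (rule weighted(2)[OF HDA H])
  qed
  also have "\<dots> \<le> N * (cmod L / (N + 1))"
    using small N by (intro mult_left_mono) (auto simp: H_def)
  also have "\<dots> < cmod L" using N L by (simp add: field_simps)
  finally show False by simp
qed

section \<open>Powers of one minus the coordinate product\<close>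

text \<open>
  The finite difference of order \<open>n\<close> of a polynomial of degree \<open>q < n\<close>.  Each unit difference lowers the
  lower index of the binomial coefficient by one (Pascal's rule).
\<close>

lemma alternating_binomial_moments:
  assumes "q < n"
  shows "(\<Sum>i\<le>n. (-1) ^ i * of_nat (n choose i) * of_nat ((i + j) choose q) :: complex) = 0"
  using assms
proof (induction n arbitrary: q j)
  case 0
  then show ?case by simp
next
  case (Suc n)
  define S where "S n q j = (\<Sum>i\<le>n. (-1) ^ i * of_nat (n choose i) * of_nat ((i + j) choose q) :: complex)" for n q j
  have step: "S (Suc n) q j = S n q j - S n q (Suc j)"
  proof -
    have "S (Suc n) q j = of_nat (j choose q) + 
        (\<Sum>i\<le>n. (-1) ^ Suc i * of_nat (Suc n choose Suc i) * of_nat ((Suc i + j) choose q))"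
      unfolding S_def by (subst sum.atMost_Suc_shift) simp
    also have "\<dots> = (of_nat (j choose q) + 
          (\<Sum>i\<le>n. (-1) ^ Suc i * of_nat (n choose Suc i) * of_nat ((Suc i + j) choose q))) - S n q (Suc j)"
      unfolding S_def by (simp add: sum.distrib[symmetric] sum_subtractf[symmetric] sum_negf algebra_simps)
    also have "of_nat (j choose q) + 
          (\<Sum>i\<le>n. (-1) ^ Suc i * of_nat (n choose Suc i) * of_nat ((Suc i + j) choose q))
        = (\<Sum>i\<le>Suc n. (-1) ^ i * of_nat (n choose i) * of_nat ((i + j) choose q) :: complex)"
      by (subst sum.atMost_Suc_shift) simp
    also have "\<dots> = S n q j" unfolding S_def by simp
    finally show ?thesis .
  qed
  show ?case
  proof (cases q)
    case 0
    have "S n 0 j = S n 0 (Suc j)" by (simp add: S_def)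
    with step 0 show ?thesis by (simp add: S_def)
  next
    case (Suc r)
    have "S n q (Suc j) = S n q j + S n r j"
      unfolding S_def Suc by (simp add: sum.distrib[symmetric] algebra_simps)
    moreover have "S n r j = 0" unfolding S_def using Suc Suc.prems by (intro Suc.IH) simp
    ultimately show ?thesis using step by (simp add: S_def)
  qed
qed

lemma one_minus_power_sums:
  "(\<lambda>i. (-1) ^ i * of_nat (n choose i) * l ^ i) sums ((1 - l) ^ n :: complex)"
proof -
  have "(\<lambda>i. (-1) ^ i * of_nat (n choose i) * l ^ i) sums (\<Sum>i\<le>n. (-1) ^ i * of_nat (n choose i) * l ^ i)"
    by (rule sums_finite) auto
  also have "(\<Sum>i\<le>n. (-1) ^ i * of_nat (n choose i) * l ^ i) = (1 - l) ^ n"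
    using binomial_ring[of "- l" 1 n] by (simp add: power_minus[of l] mult_ac)
  finally show ?thesis .
qed

lemma one_minus_peak_power_in_drury_arveson:
  fixes J :: "'d::finite set"
  assumes "J \<noteq> {}"
  shows "(\<lambda>z. (1 - peak J z) ^ n) \<in> drury_arveson"
proof (rule drury_arveson_compose_peak[OF assms one_minus_power_sums])
  show "summable (\<lambda>m. diag_weight (card J) m * (cmod ((- 1) ^ m * of_nat (n choose m)))\<^sup>2)"
    by (rule summable_finite[of "{..n}"]) auto
qed

lemma binomial_le_power_Suc: "real (m choose q) \<le> (real m + 1) ^ q"
proof -
  have "m choose q \<le> m ^ q"
    by (cases "q \<le> m") (auto simp: binomial_le_pow binomial_eq_0)
  then have "real (m choose q) \<le> real m ^ q"
    by (simp only: of_nat_le_iff of_nat_power[symmetric])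
  also have "\<dots> \<le> (real m + 1) ^ q" by (intro power_mono) auto
  finally show ?thesis .
qed

text \<open>
  Pairing with the binomial coefficients over \<open>n - 1\<close> is, up to a factor, the derivative of order \<open>n - 1\<close> at
  \<open>1\<close>.  For \<open>k \<ge> 4 n\<close> the squares of these coefficients divided by \<open>(m + 1)\<^bsup>(k-1)/2\<^esup>\<close> are at most
  \<open>(m + 1)\<^bsup>-3/2\<^esup>\<close>.
\<close>

lemma one_minus_peak_powers_differ:
  fixes J :: "'d::finite set"
  assumes n: "n \<ge> 1" and J: "card J \<ge> 4 * n"
  shows "inv_subspace (\<lambda>z. (1 - peak J z) ^ (n - 1)) \<noteq> inv_subspace (\<lambda>z. (1 - peak J z) ^ n)"
proof -
  have ne: "J \<noteq> {}" using n J by auto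
  define p where "p m = (real m + 1) powr ((real (card J) - 1) / 4)" for m
  define \<nu> where "\<nu> m = complex_of_nat (m choose (n - 1))" for m
  have "(\<lambda>z. (1 - peak J z) ^ (n - 1)) \<notin> inv_subspace (\<lambda>z. (1 - peak J z) ^ n)"
  proof (rule not_in_inv_subspace[OF ne, where F = "\<lambda>l. (1 - l) ^ n" and G = "\<lambda>l. (1 - l) ^ (n - 1)" and \<nu> = \<nu>
        and L = "(-1) ^ (n - 1)"])
    show "(\<lambda>m. ((-1) ^ m * of_nat (n choose m)) * l ^ m) sums (1 - l) ^ n" for l :: complex
      by (rule one_minus_power_sums)
    show "(\<lambda>m. ((-1) ^ m * of_nat ((n - 1) choose m)) * l ^ m) sums (1 - l) ^ (n - 1)" for l :: complex
      by (rule one_minus_power_sums)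
    show "summable (\<lambda>i. cmod ((- 1) ^ i * of_nat (n choose i)) * (real i + 1) powr ((real (card J) - 1) / 4))"
      by (rule summable_finite[of "{..n}"]) auto
    show "summable (\<lambda>m. (cmod (\<nu> m) / (real m + 1) powr ((real (card J) - 1) / 4))\<^sup>2)"
    proof (rule summable_comparison_test')
      show "summable (\<lambda>m. real (Suc m) powr (- 3 / 2))"
        using summable_real_powr_iff[of "- 3 / 2"] by (subst summable_Suc_iff) simp
      fix m :: nat
      have "cmod (\<nu> m) \<le> (real m + 1) powr (real n - 1)"
        using binomial_le_power_Suc[of m "n - 1"] n by (simp add: \<nu>_def powr_realpow[symmetric] of_nat_diff)
      moreover have "(real m + 1) powr (real n - 1 + 3 / 4) \<le> (real m + 1) powr ((real (card J) - 1) / 4)"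
        using J by (intro powr_mono) auto
      ultimately have "cmod (\<nu> m) / (real m + 1) powr ((real (card J) - 1) / 4)
          \<le> (real m + 1) powr (real n - 1) / (real m + 1) powr (real n - 1 + 3 / 4)"
        by (intro frac_le) auto
      also have "\<dots> = (real m + 1) powr (- 3 / 4)" by (simp add: powr_diff[symmetric])
      finally have "(cmod (\<nu> m) / (real m + 1) powr ((real (card J) - 1) / 4))\<^sup>2 \<le> ((real m + 1) powr (- 3 / 4))\<^sup>2"
        by (intro power_mono) auto
      then show "norm ((cmod (\<nu> m) / (real m + 1) powr ((real (card J) - 1) / 4))\<^sup>2) \<le> real (Suc m) powr (- 3 / 2)"
        by (simp add: powr_power add.commute)
    qed
    show "(\<lambda>i. (- 1) ^ i * of_nat (n choose i) * \<nu> (i + j)) sums 0" for j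
    proof -
      have "(\<lambda>i. (- 1) ^ i * of_nat (n choose i) * \<nu> (i + j)) sums (\<Sum>i\<le>n. (- 1) ^ i * of_nat (n choose i) * \<nu> (i + j))"
        by (rule sums_finite) auto
      then show ?thesis unfolding \<nu>_def using alternating_binomial_moments[of "n - 1" n j] n by simp
    qed
    show "(\<lambda>m. \<nu> m * ((- 1) ^ m * of_nat ((n - 1) choose m))) sums (- 1) ^ (n - 1)"
    proof -
      have "(\<lambda>m. \<nu> m * ((- 1) ^ m * of_nat ((n - 1) choose m))) sums 
          (\<Sum>m\<in>{n - 1}. \<nu> m * ((- 1) ^ m * of_nat ((n - 1) choose m)))"
        by (rule sums_finite) (auto simp: \<nu>_def not_less binomial_eq_0 neq_iff)
      then show ?thesis by (simp add: \<nu>_def)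
    qed
  qed (use one_minus_peak_power_in_drury_arveson[OF ne] in auto)
  moreover have "(\<lambda>z. (1 - peak J z) ^ (n - 1)) \<in> inv_subspace (\<lambda>z. (1 - peak J z) ^ (n - 1))"
    by (rule self_in_inv_subspace[OF one_minus_peak_power_in_drury_arveson[OF ne]])
  ultimately show ?thesis by auto
qed

lemma one_minus_peak_stable:
  fixes J :: "'d::finite set"
  assumes J: "J \<noteq> {}"
  shows "(\<lambda>z. 1 - peak J z) \<in> stable_polynomials"
proof -
  let ?c = "\<lambda>\<alpha>. if \<alpha> = diag_index J 0 then 1 else - complex_of_real (peak_const J)"
  have ne: "diag_index J 0 \<noteq> diag_index J 1"
    using inj_diag_index[OF J] by (metis inj_eq zero_neq_one)
  have "1 - peak J z = (\<Sum>\<alpha>\<in>{diag_index J 0, diag_index J 1}. ?c \<alpha> * monomial \<alpha> z)" for z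
    using ne by (simp add: monomial_diag_index peak_def)
  moreover have "1 - peak J z \<noteq> 0" if "z \<in> ball 0 1" for z
    using peak_in_disc[OF J that] by auto
  ultimately show ?thesis
    unfolding stable_polynomials_def
    by (intro CollectI conjI exI[of _ "{diag_index J 0, diag_index J 1}"] exI[of _ ?c]) auto
qed

lemma tau_eq_peak:
  fixes e :: "nat \<Rightarrow> 'd::finite"
  assumes "inj_on e {1..k}"
  shows "tau e k = peak (e ` {1..k})" and "card (e ` {1..k}) = k"
proof -
  show c: "card (e ` {1..k}) = k" using card_image[OF assms] by simp
  show "tau e k = peak (e ` {1..k})"
    unfolding fun_eq_iff tau_def peak_def peak_const_def c
    by (intro allI) (simp only: prod.reindex[OF assms] o_def)
qed

section \<open>Moments of a Cantor measure\<close>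

text \<open>
  A finite set \<open>A\<close> stands for the ternary expansion with digit \<open>1\<close> at the positions in \<open>A\<close> and digit \<open>0\<close>
  elsewhere.
\<close>

definition cantor_point :: "nat set \<Rightarrow> complex" where
  "cantor_point A = cis (2 * pi * (\<Sum>i\<in>A. (1/3) ^ Suc i))"

text \<open>
  The moment of order \<open>m\<close> of the uniform measure on the \<open>2\<^sup>K\<close> points with digits at the first \<open>K\<close> places,
  written as the product that independence of the digits gives.
\<close>

definition cantor_moment :: "nat \<Rightarrow> nat \<Rightarrow> complex" where
  "cantor_moment K m = (\<Prod>i<K. (1 + cis (2 * pi * real m * (1/3) ^ Suc i)) / 2)"

lemma cantor_point_power:
  assumes "finite A"
  shows "cantor_point A ^ m = (\<Prod>i\<in>A. cis (2 * pi * real m * (1/3) ^ Suc i))"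
  using assms
proof (induction A rule: finite_induct)
  case empty
  then show ?case by (simp add: cantor_point_def)
next
  case (insert i A)
  then have "cantor_point (insert i A) = cis (2 * pi * (1/3) ^ Suc i) * cantor_point A"
    by (simp add: cantor_point_def cis_mult distrib_left)
  then have "cantor_point (insert i A) ^ m = cis (2 * pi * (1/3) ^ Suc i) ^ m * cantor_point A ^ m"
    by (simp only: power_mult_distrib)
  also have "cis (2 * pi * (1/3) ^ Suc i) ^ m = cis (2 * pi * real m * (1/3) ^ Suc i)"
    by (subst Complex.DeMoivre) (simp only: mult_ac)
  finally show ?case using insert by simp
qed

lemma cantor_moment_eq_average:
  "cantor_moment K m = (\<Sum>A\<in>Pow {..<K}. cantor_point A ^ m) / 2 ^ K"
proof -
  have "cantor_moment K m = (\<Prod>i<K. cis (2 * pi * real m * (1/3) ^ Suc i) + 1) / 2 ^ K"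
    unfolding cantor_moment_def prod_dividef by (simp add: add.commute)
  also have "(\<Prod>i<K. cis (2 * pi * real m * (1/3) ^ Suc i) + 1)
      = (\<Sum>A\<in>Pow {..<K}. \<Prod>i\<in>A. cis (2 * pi * real m * (1/3) ^ Suc i))"
    by (subst prod_add) simp_all
  also have "\<dots> = (\<Sum>A\<in>Pow {..<K}. cantor_point A ^ m)"
    by (rule sum.cong) (auto simp: cantor_point_power finite_subset)
  finally show ?thesis .
qed

lemma norm_one_plus_cis_half: "cmod ((1 + cis x) / 2) \<le> 1"
  using norm_triangle_ineq[of 1 "cis x"] by (simp add: norm_divide)

lemma norm_cantor_moment_le_1: "cmod (cantor_moment K m) \<le> 1"
  unfolding cantor_moment_def prod_norm[symmetric]
  by (rule prod_le_1) (use norm_one_plus_cis_half in auto)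

lemma cantor_moment_Suc:
  "cantor_moment (Suc K) m = cantor_moment K m * ((1 + cis (2 * pi * real m * (1/3) ^ Suc K)) / 2)"
  by (simp add: cantor_moment_def)

lemma norm_cantor_moment_antimono:
  assumes "K \<le> K'"
  shows "cmod (cantor_moment K' m) \<le> cmod (cantor_moment K m)"
  using assms
proof (induction K' rule: dec_induct)
  case (step n)
  have "cmod (cantor_moment (Suc n) m) \<le> cmod (cantor_moment n m) * 1"
    unfolding cantor_moment_Suc norm_mult by (intro mult_left_mono norm_one_plus_cis_half) simp
  with step show ?case by simp
qed simp

lemma norm_cis_diff_le: "cmod (cis x - cis y) \<le> \<bar>x - y\<bar>"
proof -
  have "cis x - cis y = cis y * (cis (x - y) - 1)" by (simp add: cis_mult right_diff_distrib)
  then have "cmod (cis x - cis y) = cmod (exp (\<i> * of_real (x - y)) - 1)"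
    by (simp add: norm_mult cis_conv_exp)
  also have "\<dots> = 2 * \<bar>sin ((x - y) / 2)\<bar>" by (rule dist_exp_i_1)
  also have "\<dots> \<le> \<bar>x - y\<bar>" using abs_sin_x_le_abs_x[of "(x - y) / 2"] by simp
  finally show ?thesis .
qed

definition cantor_limit :: "nat \<Rightarrow> complex" where
  "cantor_limit m = lim (\<lambda>K. cantor_moment K m)"

lemma cantor_moment_tendsto: "(\<lambda>K. cantor_moment K m) \<longlonglongrightarrow> cantor_limit m"
proof -
  have "summable (\<lambda>K. cantor_moment (Suc K) m - cantor_moment K m)"
  proof (rule summable_comparison_test')
    show "summable (\<lambda>K. (pi * real m / 3) * (1/3 :: real) ^ K)"
      by (intro summable_mult summable_geometric) simp
    fix K
    let ?x = "2 * pi * real m * (1/3) ^ Suc K"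
    have "cantor_moment (Suc K) m - cantor_moment K m = cantor_moment K m * ((cis ?x - cis 0) / 2)"
    proof -
      have "M * ((1 + c) / 2) - M = M * ((c - 1) / 2)" for M c :: complex
        by (simp add: field_simps)
      then show ?thesis by (simp only: cantor_moment_Suc cis_zero)
    qed
    then have "cmod (cantor_moment (Suc K) m - cantor_moment K m) 
        = cmod (cantor_moment K m) * (cmod (cis ?x - cis 0) / 2)"
      by (simp only: norm_mult norm_divide norm_numeral)
    also have "\<dots> \<le> 1 * (\<bar>?x - 0\<bar> / 2)"
      by (intro mult_mono divide_right_mono norm_cantor_moment_le_1 norm_cis_diff_le) auto
    also have "\<dots> = (pi * real m / 3) * (1/3) ^ K"
    proof -
      have "?x \<ge> 0" by simp
      then show ?thesis by (simp only: diff_zero abs_of_nonneg) simp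
    qed
    finally show "norm (cantor_moment (Suc K) m - cantor_moment K m) \<le> (pi * real m / 3) * (1/3) ^ K" .
  qed
  then have "convergent (\<lambda>n. \<Sum>K<n. cantor_moment (Suc K) m - cantor_moment K m)"
    by (simp add: summable_iff_convergent)
  then have "convergent (\<lambda>n. cantor_moment n m - cantor_moment 0 m)"
    by (simp only: sum_lessThan_telescope[of "\<lambda>K. cantor_moment K m"])
  then have "convergent (\<lambda>n. cantor_moment n m)"
    by (simp only: convergent_diff_const_right_iff)
  then show ?thesis unfolding cantor_limit_def by (simp add: convergent_LIMSEQ_iff)
qed

lemma norm_cantor_limit_le: "cmod (cantor_limit m) \<le> cmod (cantor_moment K m)"
proof (rule tendsto_upperbound)
  show "(\<lambda>n. cmod (cantor_moment n m)) \<longlonglongrightarrow> cmod (cantor_limit m)"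
    by (intro tendsto_norm cantor_moment_tendsto)
  show "\<forall>\<^sub>F n in sequentially. cmod (cantor_moment n m) \<le> cmod (cantor_moment K m)"
    using eventually_ge_at_top[of K] by eventually_elim (rule norm_cantor_moment_antimono)
qed simp

lemma cantor_limit_0: "cantor_limit 0 = 1"
proof -
  have "cantor_moment K 0 = 1" for K by (simp add: cantor_moment_def)
  then show ?thesis using cantor_moment_tendsto[of 0] by (simp add: LIMSEQ_const_iff)
qed

text \<open>
  The \<open>K\<close>-th approximating measure lives on roots of unity of order \<open>3\<^sup>K\<close>.
\<close>

lemma cantor_moment_periodic: "cantor_moment K (m + j * 3 ^ K) = cantor_moment K m"
  unfolding cantor_moment_def
proof (rule prod.cong[OF refl])
  fix i assume "i \<in> {..<K}"
  then have K: "(3::real) ^ K = 3 ^ (K - Suc i) * 3 ^ Suc i"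
    by (simp only: power_add[symmetric] lessThan_iff) simp
  have "(3::real) ^ K * (1/3) ^ Suc i = 3 ^ (K - Suc i)"
    unfolding K power_divide power_one by (simp del: power_Suc)
  then have "2 * pi * real (m + j * 3 ^ K) * (1/3) ^ Suc i
      = 2 * pi * real m * (1/3) ^ Suc i + 2 * pi * real (j * 3 ^ (K - Suc i))"
    by (simp only: of_nat_add of_nat_mult of_nat_power of_nat_numeral distrib_left distrib_right mult.assoc)
  moreover have "cis (2 * pi * real n) = 1" for n
    using cis_multiple_2pi[of "real n"] by simp
  ultimately show "(1 + cis (2 * pi * real (m + j * 3 ^ K) * (1/3) ^ Suc i)) / 2 
      = (1 + cis (2 * pi * real m * (1/3) ^ Suc i)) / 2"
    by (simp only: cis_mult[symmetric]) simp
qed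

lemma norm_one_plus_cis_half_sq: "(cmod ((1 + cis x) / 2))\<^sup>2 = (1 + cos x) / 2"
proof -
  have "(1 + cos x)\<^sup>2 + (sin x)\<^sup>2 = 2 * (1 + cos x)"
    using sin_cos_squared_add[of x] by (simp add: power2_eq_square algebra_simps)
  then show ?thesis by (simp add: norm_divide power_divide cmod_power2)
qed

lemma cos_thirds_sum: "cos x + cos (x + 2 * pi / 3) + cos (x + 4 * pi / 3) = 0"
proof -
  have "cos (2 * pi / 3) = - 1/2" using cos_120 by simp
  moreover have "cos (4 * pi / 3) = - 1/2" 
  proof -
    have "cos (4 * pi / 3) = cos (pi / 3 + pi)" by (rule arg_cong[where f = cos]) simp
    then show ?thesis using cos_60 by (simp only: cos_periodic_pi)
  qed
  moreover have "sin (4 * pi / 3) = - sin (2 * pi / 3)"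
  proof -
    have "sin (4 * pi / 3) = sin (2 * pi - 2 * pi / 3)" by (rule arg_cong[where f = sin]) simp
    then show ?thesis by (simp only: sin_2pi_minus)
  qed
  ultimately show ?thesis by (simp add: cos_add)
qed

text \<open>
  This says that \<open>3\<^sup>K\<close> times the sum of the squared point masses is \<open>3\<^sup>K 2\<^bsup>-K\<^esup>\<close>.  The induction splits the residues
  modulo \<open>3\<^bsup>K+1\<^esup>\<close> by their residue modulo \<open>3\<^sup>K\<close>; the factor for the new digit averages to \<open>1/2\<close> over the three
  shifts by a third of a turn.
\<close>

lemma cantor_moment_square_sum:
  "(\<Sum>m<3 ^ K. (cmod (cantor_moment K m))\<^sup>2) = (3/2) ^ K"
proof (induction K)
  case 0
  then show ?case by (simp add: cantor_moment_def)
next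
  case (Suc K)
  define h where "h m = (cmod (cantor_moment (Suc K) m))\<^sup>2" for m
  define x where "x m = 2 * pi * real m * (1/3) ^ Suc K" for m
  have h: "h (m + j * 3 ^ K) = (cmod (cantor_moment K m))\<^sup>2 * ((1 + cos (x m + 2 * pi * real j / 3)) / 2)" for m j
  proof -
    have "x (m + j * 3 ^ K) = x m + 2 * pi * real j / 3"
    proof -
      have "(3::real) ^ K * (1/3) ^ Suc K = 1/3" by (simp add: power_divide)
      then have "real j * ((3::real) ^ K * (1/3) ^ Suc K) = real j / 3" by simp
      then show ?thesis
        by (simp only: x_def of_nat_add of_nat_mult of_nat_power of_nat_numeral distrib_left distrib_right mult.assoc)
    qed
    then show ?thesis
      unfolding h_def cantor_moment_Suc cantor_moment_periodic norm_mult power_mult_distrib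
      by (simp only: x_def[symmetric] norm_one_plus_cis_half_sq)
  qed
  have "(\<Sum>m<3 ^ Suc K. h m) = (\<Sum>m<3 * 3 ^ K. h m)" by simp
  also have "\<dots> = (\<Sum>j<3. sum h {j * 3 ^ K..<j * 3 ^ K + 3 ^ K})"
    by (rule sum.nat_group[symmetric])
  also have "\<dots> = (\<Sum>j<3. \<Sum>m<3 ^ K. h (m + j * 3 ^ K))"
  proof (rule sum.cong[OF refl])
    fix j
    show "sum h {j * 3 ^ K..<j * 3 ^ K + 3 ^ K} = (\<Sum>m<3 ^ K. h (m + j * 3 ^ K))"
      by (rule sum.reindex_bij_witness[where i = "\<lambda>m. m + j * 3 ^ K" and j = "\<lambda>m. m - j * 3 ^ K"]) auto
  qed
  also have "\<dots> = (\<Sum>m<3 ^ K. \<Sum>j<3. h (m + j * 3 ^ K))" by (rule sum.swap)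
  also have "\<dots> = (\<Sum>m<3 ^ K. (cmod (cantor_moment K m))\<^sup>2 * (3/2))"
  proof (rule sum.cong[OF refl])
    fix m
    have "(\<Sum>j<3. h (m + j * 3 ^ K)) = (cmod (cantor_moment K m))\<^sup>2 * 
        ((3 + (cos (x m) + cos (x m + 2 * pi / 3) + cos (x m + 4 * pi / 3))) / 2)"
      unfolding h by (simp add: numeral_3_eq_3 algebra_simps add_divide_distrib)
    then show "(\<Sum>j<3. h (m + j * 3 ^ K)) = (cmod (cantor_moment K m))\<^sup>2 * (3/2)"
      by (simp add: cos_thirds_sum)
  qed
  also have "\<dots> = (3/2) ^ Suc K" unfolding sum_distrib_right[symmetric] Suc by simp
  finally show ?case unfolding h_def .
qed

text \<open>
  The finite energy of the Cantor measure.  On the block \<open>3\<^sup>K \<le> m < 3\<^bsup>K+1\<^esup>\<close> the squared moments sum to at most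
  \<open>(3/2)\<^bsup>K+1\<^esup>\<close> and the weight is at least \<open>3\<^bsup>K/2\<^esup>\<close>, so the blocks decay like \<open>(3/2 / \<surd>3)\<^sup>K\<close>.
\<close>

lemma cantor_limit_square_summable:
  "summable (\<lambda>m. (cmod (cantor_limit m) / (real m + 1) powr (1/4))\<^sup>2)"
proof -
  define t where "t m = (cmod (cantor_limit m) / (real m + 1) powr (1/4))\<^sup>2" for m
  define q where "q = 3/2 / sqrt 3"
  have "sqrt 3 > 3/2" by (rule real_less_rsqrt) (simp add: power2_eq_square)
  then have q: "0 \<le> q" "q < 1" by (auto simp: q_def)
  have t0: "t m \<ge> 0" for m by (simp add: t_def)
  have tle: "t m \<le> (cmod (cantor_moment (Suc K) m))\<^sup>2 / sqrt 3 ^ K" if "3 ^ K \<le> m" for m K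
  proof -
    have "t m = (cmod (cantor_limit m))\<^sup>2 / ((real m + 1) powr (1/4))\<^sup>2"
      by (simp add: t_def power_divide)
    also have "((real m + 1) powr (1/4))\<^sup>2 = sqrt (real m + 1)"
      by (simp add: powr_power powr_half_sqrt[symmetric])
    also have "(cmod (cantor_limit m))\<^sup>2 / sqrt (real m + 1) 
        \<le> (cmod (cantor_moment (Suc K) m))\<^sup>2 / sqrt (3 ^ K)"
    proof (intro frac_le power_mono norm_cantor_limit_le real_sqrt_le_mono)
      have "real (3 ^ K) \<le> real m" using that by (simp only: of_nat_le_iff)
      then have "(3::real) ^ K \<le> real m" by (simp only: of_nat_power of_nat_numeral)
      then show "(3::real) ^ K \<le> real m + 1" by (rule order_trans) simp
    qed auto
    finally show ?thesis by (simp add: real_sqrt_power)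
  qed
  have block: "(\<Sum>m<3 ^ K. t m) \<le> 1 + (\<Sum>k<K. 3/2 * q ^ k)" for K
  proof (induction K)
    case 0
    then show ?case by (simp add: t_def cantor_limit_0)
  next
    case (Suc K)
    have "(\<Sum>m<3 ^ Suc K. t m) = (\<Sum>m<3 ^ K. t m) + (\<Sum>m\<in>{3 ^ K..<3 ^ Suc K}. t m)"
    proof -
      have "(3::nat) ^ K \<le> 3 ^ Suc K" by simp
      then show ?thesis
        by (metis atLeast0LessThan sum.atLeastLessThan_concat zero_le)
    qed
    also have "(\<Sum>m\<in>{3 ^ K..<3 ^ Suc K}. t m) 
        \<le> (\<Sum>m\<in>{3 ^ K..<3 ^ Suc K}. (cmod (cantor_moment (Suc K) m))\<^sup>2 / sqrt 3 ^ K)"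
      by (intro sum_mono tle) simp
    also have "\<dots> \<le> (\<Sum>m<3 ^ Suc K. (cmod (cantor_moment (Suc K) m))\<^sup>2 / sqrt 3 ^ K)"
      by (rule sum_mono2) auto
    also have "\<dots> = (3/2) ^ Suc K / sqrt 3 ^ K"
      unfolding sum_divide_distrib[symmetric] cantor_moment_square_sum ..
    also have "\<dots> = 3/2 * q ^ K" by (simp add: q_def power_divide)
    finally show ?case using Suc by simp
  qed
  have "summable t"
  proof (rule summableI_nonneg_bounded[OF t0])
    fix n :: nat
    have "(\<Sum>m<n. t m) \<le> (\<Sum>m<3 ^ n. t m)"
      by (rule sum_mono2) (use t0 less_exp[of n] in \<open>auto intro: less_le_trans[OF _ self_le_ge2_pow]\<close>)
    also have "\<dots> \<le> 1 + (\<Sum>k<n. 3/2 * q ^ k)" by (rule block)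
    also have "(\<Sum>k<n. 3/2 * q ^ k) \<le> (\<Sum>k. 3/2 * q ^ k)"
      by (rule sum_le_suminf) (use q in \<open>auto intro!: summable_mult summable_geometric\<close>)
    finally show "(\<Sum>m<n. t m) \<le> 1 + (\<Sum>k. 3/2 * q ^ k)" by simp
  qed
  then show ?thesis unfolding t_def .
qed

section \<open>A potential that is infinite on the Cantor set\<close>

lemma norm_cantor_point [simp]: "cmod (cantor_point A) = 1"
  by (simp add: cantor_point_def)

text \<open>
  The \<open>p\<close>-th derivative of \<open>z \<mapsto> \<Sum> 1 / (1 + 3\<^bsup>-k\<^esup> - z \<zeta>\<^sup>*)\<close>, where \<open>\<zeta>\<close> runs over the \<open>2\<^sup>k\<close> points of
  level \<open>k\<close> and \<open>\<zeta>\<^sup>*\<close> is the conjugate.  The poles have distance \<open>3\<^bsup>-k\<^esup>\<close> from the disc, which is the scale of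
  level \<open>k\<close>.
\<close>

definition cantor_kernel :: "nat \<Rightarrow> nat \<Rightarrow> complex \<Rightarrow> complex" where
  "cantor_kernel p k z = (\<Sum>A\<in>Pow {..<k}. fact p * cnj (cantor_point A) ^ p *
     inverse ((of_real (1 + (1/3) ^ k) - z * cnj (cantor_point A)) ^ Suc p))"

text \<open>
  The ratio \<open>4/9\<close> lies strictly between \<open>1/3\<close> and \<open>1/2\<close>: against the \<open>2\<^sup>k\<close> summands of level
  \<open>k\<close> it gives a convergent series, against the size \<open>3\<^sup>k\<close> of a summand near its pole it gives growth.
\<close>

definition cantor_potential :: "nat \<Rightarrow> complex \<Rightarrow> complex" where
  "cantor_potential p z = (\<Sum>k. (4/9) ^ k * cantor_kernel p k z)"

lemma Re_denominator_ge:
  assumes "cmod z \<le> 1"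
  shows "Re (of_real (1 + (1/3) ^ k) - z * cnj (cantor_point A)) \<ge> (1/3) ^ k"
proof -
  have "Re (z * cnj (cantor_point A)) \<le> cmod (z * cnj (cantor_point A))" by (rule complex_Re_le_cmod)
  also have "\<dots> \<le> 1" using assms by (simp add: norm_mult)
  finally show ?thesis by (simp only: minus_complex.sel Re_complex_of_real)
qed

lemma denominator_nonzero:
  assumes "cmod z \<le> 1"
  shows "of_real (1 + (1/3) ^ k) - z * cnj (cantor_point A) \<noteq> 0"
proof
  assume "of_real (1 + (1/3) ^ k) - z * cnj (cantor_point A) = 0"
  then have "(1/3) ^ k \<le> (0::real)" using Re_denominator_ge[OF assms, of k A] by (simp only: zero_complex.sel)
  moreover have "(1/3 :: real) ^ k > 0" by simp
  ultimately show False by linarith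
qed

text \<open>
  Moving the pole radially away from the disc only increases the distance to it.
\<close>

lemma norm_denominator_ge:
  assumes "cmod z \<le> 1"
  shows "cmod (of_real (1 + (1/3) ^ k) - z * cnj (cantor_point A)) \<ge> cmod (z - cantor_point A)"
proof -
  define w where "w = z * cnj (cantor_point A)"
  define e :: real where "e = (1/3) ^ k"
  have e: "e \<ge> 0" by (simp add: e_def)
  have "Re w \<le> cmod w" by (rule complex_Re_le_cmod)
  also have "\<dots> \<le> 1" using assms by (simp add: w_def norm_mult)
  finally have w: "Re w \<le> 1" .
  have "cantor_point A * cnj (cantor_point A) = 1"
    using complex_norm_square[of "cantor_point A"] by simp
  then have "cantor_point A * (w - 1) = z - cantor_point A"
    unfolding w_def by (simp add: algebra_simps)
  then have "cmod (z - cantor_point A) = cmod (w - 1)"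
    by (metis norm_cantor_point norm_mult mult_1)
  also have "\<dots> \<le> cmod (of_real (1 + e) - w)"
  proof (rule power2_le_imp_le)
    have "(1 - Re w)\<^sup>2 \<le> (1 + e - Re w)\<^sup>2" by (rule power_mono) (use e w in auto)
    then show "(cmod (w - 1))\<^sup>2 \<le> (cmod (of_real (1 + e) - w))\<^sup>2"
      by (simp add: cmod_power2 power2_commute[of "Re w" 1])
  qed simp
  finally show ?thesis unfolding w_def e_def .
qed

lemma norm_cantor_kernel_le:
  assumes z: "cmod z \<le> 1" and d: "d > 0" and far: "\<And>A. finite A \<Longrightarrow> d \<le> cmod (z - cantor_point A)"
  shows "cmod (cantor_kernel p k z) \<le> 2 ^ k * (fact p / d ^ Suc p)"
proof -
  have "cmod (cantor_kernel p k z) \<le> (\<Sum>A\<in>Pow {..<k}. fact p / d ^ Suc p)"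
    unfolding cantor_kernel_def
  proof (rule sum_norm_le)
    fix A assume "A \<in> Pow {..<k}"
    then have "finite A" by (auto intro: finite_subset)
    then have "d \<le> cmod (of_real (1 + (1/3) ^ k) - z * cnj (cantor_point A))"
      using far norm_denominator_ge[OF z] order_trans by blast
    then have "d ^ Suc p \<le> cmod (of_real (1 + (1/3) ^ k) - z * cnj (cantor_point A)) ^ Suc p"
      using d by (intro power_mono) auto
    then have "fact p / cmod (of_real (1 + (1/3) ^ k) - z * cnj (cantor_point A)) ^ Suc p \<le> fact p / d ^ Suc p"
      using zero_less_power[OF d, of "Suc p"] by (intro frac_le) (simp_all del: power_Suc)
    then show "cmod (fact p * cnj (cantor_point A) ^ p *
        inverse ((of_real (1 + (1/3) ^ k) - z * cnj (cantor_point A)) ^ Suc p)) \<le> fact p / d ^ Suc p"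
      by (simp only: norm_mult norm_inverse norm_power norm_fact complex_mod_cnj norm_cantor_point 
          power_one mult_1_right divide_inverse)
  qed
  also have "\<dots> = 2 ^ k * (fact p / d ^ Suc p)" by (simp add: card_Pow)
  finally show ?thesis .
qed

lemma cantor_term_le:
  assumes "cmod (cantor_kernel p k z) \<le> 2 ^ k * C"
  shows "cmod ((4/9) ^ k * cantor_kernel p k z) \<le> (8/9) ^ k * C"
proof -
  have "cmod ((4/9) ^ k * cantor_kernel p k z) \<le> (4/9) ^ k * (2 ^ k * C)"
    unfolding norm_mult norm_power using assms by (intro mult_mono) auto
  also have "\<dots> = (8/9) ^ k * C" by (simp add: power_mult_distrib[symmetric] mult.assoc[symmetric])
  finally show ?thesis .
qed

lemma cantor_point_far:
  "1 - cmod z \<le> cmod (z - cantor_point A)"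
  using norm_triangle_ineq2[of "cantor_point A" z] by (simp add: norm_minus_commute)

lemma cantor_potential_sums:
  assumes "cmod z < 1"
  shows "(\<lambda>k. (4/9) ^ k * cantor_kernel p k z) sums cantor_potential p z"
proof -
  have "summable (\<lambda>k. (4/9) ^ k * cantor_kernel p k z)"
  proof (rule summable_comparison_test')
    show "summable (\<lambda>k. (8/9 :: real) ^ k * (fact p / (1 - cmod z) ^ Suc p))"
      by (intro summable_mult2 summable_geometric) simp
    show "norm ((4/9) ^ k * cantor_kernel p k z) \<le> (8/9) ^ k * (fact p / (1 - cmod z) ^ Suc p)" for k
      by (intro cantor_term_le norm_cantor_kernel_le cantor_point_far) (use assms in auto)
  qed
  then show ?thesis unfolding cantor_potential_def by (rule summable_sums)
qed

text \<open>
  The constant \<open>9\<close> is the sum of the geometric series with ratio \<open>2 * 4/9\<close>.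
\<close>

lemma norm_cantor_potential_le:
  assumes z: "cmod z < 1" and d: "d > 0" and far: "\<And>A. finite A \<Longrightarrow> d \<le> cmod (z - cantor_point A)"
  shows "cmod (cantor_potential p z) \<le> 9 * (fact p / d ^ Suc p)"
proof -
  have "(\<lambda>k. (8/9 :: real) ^ k) sums (1 / (1 - 8/9))" by (rule geometric_sums) simp
  then have "(\<lambda>k. (8/9) ^ k * (fact p / d ^ Suc p)) sums (9 * (fact p / d ^ Suc p))"
    by (intro sums_mult2) simp
  then show ?thesis
    by (rule norm_sums_le[OF cantor_potential_sums[OF z]])
       (intro cantor_term_le norm_cantor_kernel_le far d, use z in auto)
qed

lemma inverse_power_derivative:
  fixes r c z :: complex
  assumes "r - z * c \<noteq> 0"
  shows "((\<lambda>z. inverse ((r - z * c) ^ Suc p)) has_field_derivative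
           of_nat (Suc p) * c * inverse ((r - z * c) ^ Suc (Suc p))) (at z)"
proof -
  define D where "D = r - z * c"
  have "((\<lambda>z. inverse ((r - z * c) ^ Suc p)) has_field_derivative
      - (inverse (D ^ Suc p) * (of_nat (Suc p) * (D ^ p * - c)) * inverse (D ^ Suc p))) (at z)"
    unfolding D_def using assms
    by (auto intro!: derivative_eq_intros simp del: power_Suc)
  moreover have "- (inverse (D ^ Suc p) * (of_nat (Suc p) * (D ^ p * - c)) * inverse (D ^ Suc p))
      = of_nat (Suc p) * c * inverse (D ^ Suc (Suc p))"
  proof -
    have "D \<noteq> 0" using assms by (simp add: D_def)
    then have "inverse (D ^ Suc p) * D ^ p * inverse (D ^ Suc p) = inverse (D ^ Suc (Suc p))"
      by (simp add: field_simps)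
    then have "of_nat (Suc p) * c * (inverse (D ^ Suc p) * D ^ p * inverse (D ^ Suc p))
      = of_nat (Suc p) * c * inverse (D ^ Suc (Suc p))" by (simp only:)
    then show ?thesis by (simp only: mult_ac mult_minus_left mult_minus_right minus_minus)
  qed
  ultimately show ?thesis unfolding D_def by (simp only:)
qed

lemma cantor_kernel_derivative:
  assumes "cmod z \<le> 1"
  shows "(cantor_kernel p k has_field_derivative cantor_kernel (Suc p) k z) (at z)"
proof -
  let ?c = "\<lambda>A. cnj (cantor_point A)" and ?r = "complex_of_real (1 + (1/3) ^ k)"
  have "((\<lambda>z. \<Sum>A\<in>Pow {..<k}. fact p * ?c A ^ p * inverse ((?r - z * ?c A) ^ Suc p)) has_field_derivative
     (\<Sum>A\<in>Pow {..<k}. fact p * ?c A ^ p * (of_nat (Suc p) * ?c A * inverse ((?r - z * ?c A) ^ Suc (Suc p))))) (at z)"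
    by (intro DERIV_sum DERIV_cmult inverse_power_derivative denominator_nonzero assms)
  moreover have "(\<Sum>A\<in>Pow {..<k}. fact p * ?c A ^ p * (of_nat (Suc p) * ?c A * inverse ((?r - z * ?c A) ^ Suc (Suc p))))
      = cantor_kernel (Suc p) k z"
    unfolding cantor_kernel_def
    by (intro sum.cong refl) (simp only: fact_Suc power_Suc[of "?c _" p] mult_ac)
  ultimately show ?thesis unfolding cantor_kernel_def[abs_def] by (simp only:)
qed

lemma cantor_potential_derivative:
  assumes z: "cmod z < 1"
  shows "(cantor_potential p has_field_derivative cantor_potential (Suc p) z) (at z)"
proof -
  have "\<exists>g g'. \<forall>x\<in>ball 0 1. ((\<lambda>k. (4/9) ^ k * cantor_kernel p k x) sums g x) \<and> 
      ((\<lambda>k. (4/9) ^ k * cantor_kernel (Suc p) k x) sums g' x) \<and> (g has_field_derivative g' x) (at x)"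
  proof (rule series_and_derivative_comparison_complex)
    show "((\<lambda>x. (4/9) ^ k * cantor_kernel p k x) has_field_derivative (4/9) ^ k * cantor_kernel (Suc p) k x) (at x)"
      if "x \<in> ball 0 1" for k x using that by (intro DERIV_cmult cantor_kernel_derivative) auto
    fix x :: complex assume "x \<in> ball 0 1"
    then have x: "cmod x < 1" by simp
    define d where "d = (1 - cmod x) / 2"
    have d: "d > 0" using x by (simp add: d_def)
    define h where "h k = complex_of_real ((8/9) ^ k * (fact p / d ^ Suc p))" for k
    have "summable h" unfolding h_def
      by (intro summable_of_real summable_mult2 summable_geometric) simp
    moreover have "range h \<subseteq> \<real>\<^sub>\<ge>\<^sub>0" unfolding h_def using d
      by (intro image_subsetI) (subst nonneg_Reals_of_real_iff, simp)
    moreover have "cmod ((4/9) ^ k * cantor_kernel p k y) \<le> cmod (h k)" if y: "y \<in> ball x d \<inter> ball 0 1" for k y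
    proof -
      have "cmod y \<le> cmod x + d" using y norm_triangle_ineq2[of y x] by (simp add: dist_norm norm_minus_commute)
      then have "d \<le> 1 - cmod y" by (simp add: d_def field_simps)
      then have "d \<le> cmod (y - cantor_point A)" for A
        using cantor_point_far[of y A] by simp
      then have "cmod ((4/9) ^ k * cantor_kernel p k y) \<le> (8/9) ^ k * (fact p / d ^ Suc p)"
        using y d by (intro cantor_term_le norm_cantor_kernel_le) auto
      also have "\<dots> = cmod (h k)" unfolding h_def norm_of_real using d by simp
      finally show ?thesis .
    qed
    ultimately show "\<exists>d h. 0 < d \<and> summable h \<and> range h \<subseteq> \<real>\<^sub>\<ge>\<^sub>0 \<and>
        (\<forall>\<^sub>F k in sequentially. \<forall>y\<in>ball x d \<inter> ball 0 1. cmod ((4/9) ^ k * cantor_kernel p k y) \<le> cmod (h k))"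
      using d by (intro exI[of _ d] exI[of _ h]) auto
  qed simp
  then obtain g g' where g: "\<And>x. x \<in> ball 0 1 \<Longrightarrow> (\<lambda>k. (4/9) ^ k * cantor_kernel p k x) sums g x"
    "\<And>x. x \<in> ball 0 1 \<Longrightarrow> (\<lambda>k. (4/9) ^ k * cantor_kernel (Suc p) k x) sums g' x"
    "\<And>x. x \<in> ball 0 1 \<Longrightarrow> (g has_field_derivative g' x) (at x)" by blast
  have "(cantor_potential p has_field_derivative g' z) (at z)"
  proof (rule has_field_derivative_transform_within_open[OF g(3)])
    show "g x = cantor_potential p x" if "x \<in> ball 0 1" for x
      using g(1)[OF that] cantor_potential_sums[of x p] that sums_unique2 by auto
  qed (use z in auto)
  moreover have "g' z = cantor_potential (Suc p) z"
    using g(2)[of z] cantor_potential_sums[OF z] z sums_unique2 by auto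
  ultimately show ?thesis by simp
qed

lemma Re_inverse_ge:
  fixes w :: complex
  assumes "Re w \<ge> a" "cmod w \<le> b" "a \<ge> 0" "b > 0"
  shows "Re (inverse w) \<ge> a / b\<^sup>2"
proof (cases "w = 0")
  case True
  then show ?thesis using assms by simp
next
  case False
  have "a / b\<^sup>2 \<le> Re w / (cmod w)\<^sup>2"
    using assms False by (intro frac_le power_mono) auto
  also have "\<dots> = Re (inverse w)" by (simp add: cmod_power2)
  finally show ?thesis .
qed

text \<open>
  All summands have nonnegative real part, so one of them bounds the sum from below.
\<close>

lemma Re_cantor_kernel_ge:
  assumes z: "cmod z \<le> 1" and A: "A \<subseteq> {..<k}"
  shows "Re (cantor_kernel 0 k z) \<ge> Re (inverse (of_real (1 + (1/3) ^ k) - z * cnj (cantor_point A)))"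
proof -
  have "Re (inverse (of_real (1 + (1/3) ^ k) - z * cnj (cantor_point A)))
      \<le> (\<Sum>A\<in>Pow {..<k}. Re (inverse (of_real (1 + (1/3) ^ k) - z * cnj (cantor_point A))))"
  proof (rule member_le_sum)
    fix B
    show "0 \<le> Re (inverse (of_real (1 + (1/3) ^ k) - z * cnj (cantor_point B)))"
      unfolding inverse_complex.sel
      by (rule divide_nonneg_nonneg) (rule order_trans[OF _ Re_denominator_ge[OF z]], simp_all)
  qed (use A in auto)
  also have "\<dots> = Re (cantor_kernel 0 k z)"
    by (simp add: cantor_kernel_def)
  finally show ?thesis .
qed

lemma Re_cantor_kernel_nonneg: "cmod z \<le> 1 \<Longrightarrow> Re (cantor_kernel 0 k z) \<ge> 0"
proof -
  assume z: "cmod z \<le> 1"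
  have "0 \<le> Re (inverse (of_real (1 + (1/3) ^ k) - z * cnj (cantor_point {})))"
    unfolding inverse_complex.sel
    by (rule divide_nonneg_nonneg) (rule order_trans[OF _ Re_denominator_ge[OF z]], simp_all)
  then show ?thesis using Re_cantor_kernel_ge[OF z, of "{}" k] by simp
qed

lemma Re_cantor_potential_ge:
  assumes z: "cmod z < 1"
  shows "Re (cantor_potential 0 z) \<ge> (4/9) ^ k * Re (cantor_kernel 0 k z)"
proof -
  have R: "Re ((4/9) ^ k * cantor_kernel 0 k z) = (4/9) ^ k * Re (cantor_kernel 0 k z)" for k
  proof -
    have "(4/9 :: complex) ^ k = of_real ((4/9) ^ k)" by simp
    then show ?thesis by (simp only: Re_complex_of_real times_complex.sel Im_complex_of_real)
  qed
  have s: "(\<lambda>k. (4/9) ^ k * Re (cantor_kernel 0 k z)) sums Re (cantor_potential 0 z)"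
    using sums_Re[OF cantor_potential_sums[OF z, of 0]] unfolding R .
  have "sum (\<lambda>k. (4/9) ^ k * Re (cantor_kernel 0 k z)) {k} \<le> (\<Sum>k. (4/9) ^ k * Re (cantor_kernel 0 k z))"
    by (rule sum_le_suminf[OF sums_summable[OF s]]) (use z in \<open>auto intro!: mult_nonneg_nonneg Re_cantor_kernel_nonneg\<close>)
  then show ?thesis using sums_unique[OF s] by simp
qed

section \<open>A smooth function that vanishes on the Cantor set\<close>

lemma ternary_tail_sum:
  "k \<le> N \<Longrightarrow> (\<Sum>i\<in>{k..<N}. (1/3 :: real) ^ Suc i) = ((1/3) ^ k - (1/3) ^ N) / 2"
proof (induction N rule: dec_induct)
  case (step n)
  have "(\<Sum>i\<in>{k..<Suc n}. (1/3 :: real) ^ Suc i) = ((1/3) ^ k - (1/3) ^ n) / 2 + (1/3) ^ Suc n"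
    unfolding sum.atLeastLessThan_Suc[OF step.hyps(1)] step.IH ..
  also have "\<dots> = ((1/3) ^ k - (1/3) ^ Suc n) / 2"
  proof -
    have "(a - b) / 2 + 1/3 * b = (a - 1/3 * b) / 2" for a b :: real by (simp add: field_simps)
    then show ?thesis by (simp only: power_Suc)
  qed
  finally show ?case .
qed simp

text \<open>
  The digits beyond the \<open>k\<close>-th place contribute at most \<open>3\<^bsup>-k\<^esup> / 2\<close> of a turn.
\<close>

lemma cantor_point_truncation:
  assumes B: "finite B"
  shows "cmod (cantor_point B - cantor_point (B \<inter> {..<k})) \<le> pi * (1/3) ^ k"
proof -
  define s where "s A = (\<Sum>i\<in>A. (1/3 :: real) ^ Suc i)" for A :: "nat set"
  obtain N0 where N0: "B \<subseteq> {..<N0}" using B finite_nat_iff_bounded by blast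
  define N where "N = max N0 k"
  have split: "s B = s (B \<inter> {..<k}) + s (B - {..<k})"
    unfolding s_def by (metis B sum.Int_Diff)
  have "s (B - {..<k}) \<le> s {k..<N}"
    unfolding s_def by (rule sum_mono2) (use N0 in \<open>auto simp: N_def\<close>)
  also have "\<dots> = ((1/3) ^ k - (1/3) ^ N) / 2"
    unfolding s_def by (rule ternary_tail_sum) (simp add: N_def)
  also have "\<dots> \<le> (1/3) ^ k / 2" by simp
  finally have tail: "s (B - {..<k}) \<le> (1/3) ^ k / 2" .
  have "s (B - {..<k}) \<ge> 0" unfolding s_def by (rule sum_nonneg) simp
  have "cmod (cantor_point B - cantor_point (B \<inter> {..<k})) \<le> \<bar>2 * pi * s B - 2 * pi * s (B \<inter> {..<k})\<bar>"
    unfolding cantor_point_def s_def by (rule norm_cis_diff_le)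
  also have "\<dots> = 2 * pi * s (B - {..<k})"
    unfolding split using \<open>s (B - {..<k}) \<ge> 0\<close> by (simp add: distrib_left)
  also have "\<dots> \<le> 2 * pi * ((1/3) ^ k / 2)" by (rule mult_left_mono[OF tail]) simp
  finally show ?thesis by simp
qed

text \<open>
  The number \<open>d\<close> is the distance of \<open>z\<close> to the points \<open>cantor_point A\<close>, which need not be attained;
  hence the factor \<open>2\<close>.
\<close>

lemma cantor_distance:
  assumes z: "cmod z < 1"
  obtains d B where "d > 0" "\<And>A. finite A \<Longrightarrow> d \<le> cmod (z - cantor_point A)"
    "finite B" "cmod (z - cantor_point B) < 2 * d"
proof -
  define E where "E = cantor_point ` Collect finite"
  have E: "E \<noteq> {}" by (auto simp: E_def)
  define d where "d = infdist z E"
  have "1 - cmod z \<le> d" unfolding d_def infdist_notempty[OF E]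
    by (rule cINF_greatest[OF E]) (auto simp: E_def dist_norm cantor_point_far)
  then have d: "d > 0" using z by simp
  have far: "d \<le> cmod (z - cantor_point A)" if "finite A" for A
    unfolding d_def dist_norm[symmetric] by (rule infdist_le) (use that in \<open>auto simp: E_def\<close>)
  have "\<exists>x\<in>E. dist z x < 2 * d"
  proof (rule ccontr)
    assume "\<not> (\<exists>x\<in>E. dist z x < 2 * d)"
    then have "2 * d \<le> d" unfolding d_def infdist_notempty[OF E]
      by (intro cINF_greatest[OF E]) auto
    with d show False by simp
  qed
  then obtain B where "finite B" "cmod (z - cantor_point B) < 2 * d"
    by (auto simp: E_def dist_norm)
  with d far that show thesis by blast
qed

text \<open>
  At distance at most \<open>3\<^bsup>-k\<^esup>\<close> from the set, the summand of level \<open>k\<close> whose pole comes from the first \<open>k\<close> digits of a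
  nearby point has a denominator of modulus at most \<open>7 * 3\<^bsup>-k\<^esup>\<close> and real part at least \<open>3\<^bsup>-k\<^esup>\<close>, hence itself real
  part at least \<open>3\<^sup>k / 49\<close>.
\<close>

lemma Re_cantor_potential_near:
  assumes z: "cmod z < 1" and B: "finite B" "cmod (z - cantor_point B) < 2 * d" and d: "d \<le> (1/3) ^ k"
  shows "Re (cantor_potential 0 z) \<ge> (4/3) ^ k / 49"
proof -
  define A where "A = B \<inter> {..<k}"
  define e :: real where "e = (1/3) ^ k"
  have e: "e > 0" by (simp add: e_def)
  define w where "w = complex_of_real (1 + (1/3) ^ k) - z * cnj (cantor_point A)"
  have unit: "cantor_point A * cnj (cantor_point A) = 1"
    using complex_norm_square[of "cantor_point A"] by simp
  have "w = of_real e + (cantor_point A - z) * cnj (cantor_point A)"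
    unfolding w_def e_def left_diff_distrib unit by simp
  then have "cmod w \<le> cmod (of_real e) + cmod ((cantor_point A - z) * cnj (cantor_point A))"
    by (simp only: norm_triangle_ineq)
  also have "\<dots> = e + cmod (z - cantor_point A)"
    using e by (simp add: norm_mult norm_minus_commute)
  also have "cmod (z - cantor_point A) \<le> cmod (z - cantor_point B) + cmod (cantor_point B - cantor_point A)"
    using norm_triangle_ineq[of "z - cantor_point B" "cantor_point B - cantor_point A"] by simp
  also have "cmod (cantor_point B - cantor_point A) \<le> pi * e"
    unfolding A_def e_def by (rule cantor_point_truncation[OF B(1)])
  also have "pi * e \<le> 4 * e" using pi_less_4 e by (intro mult_right_mono) auto
  finally have "cmod w \<le> 7 * e" using B(2) d by (simp add: e_def)
  moreover have "Re w \<ge> e" unfolding w_def e_def by (rule Re_denominator_ge) (use z in simp)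
  ultimately have "Re (inverse w) \<ge> e / (7 * e)\<^sup>2" using e by (intro Re_inverse_ge) auto
  also have "e / (7 * e)\<^sup>2 = 3 ^ k / 49" using e by (simp add: e_def power2_eq_square power_divide)
  finally have "Re (cantor_kernel 0 k z) \<ge> 3 ^ k / 49"
    unfolding w_def by (rule order_trans) (rule Re_cantor_kernel_ge, use z in \<open>auto simp: A_def\<close>)
  then have "(4/9) ^ k * (3 ^ k / 49) \<le> (4/9) ^ k * Re (cantor_kernel 0 k z)"
    by (rule mult_left_mono) simp
  also have "\<dots> \<le> Re (cantor_potential 0 z)" by (rule Re_cantor_potential_ge[OF z])
  also have "(4/9 :: real) ^ k * (3 ^ k / 49) = (4/3) ^ k / 49"
    by (simp add: power_mult_distrib[symmetric])
  finally show ?thesis .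
qed

text \<open>
  The exponent \<open>16\<close> is chosen so that \<open>(4/3)\<^bsup>16\<^esup> \<ge> 81 = 3\<^sup>4\<close>: the bound for \<open>exp(-G)\<close> then beats the fourth power of the
  inverse distance to the Cantor set.
\<close>

lemma exp_neg_power_le:
  fixes y :: real
  assumes "y \<ge> 0"
  shows "exp (- y) * (y / 16) ^ 16 \<le> 1"
proof -
  have "(y / 16) ^ 16 \<le> exp (y / 16) ^ 16"
    using exp_ge_add_one_self[of "y / 16"] assms by (intro power_mono) linarith+
  also have "\<dots> = exp y" by (simp flip: exp_of_nat_mult)
  finally have "exp (- y) * (y / 16) ^ 16 \<le> exp (- y) * exp y" by (rule mult_left_mono) simp
  then show ?thesis by (simp flip: exp_add)
qed

definition cantor_outer :: "complex \<Rightarrow> complex" where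
  "cantor_outer z = exp (- cantor_potential 0 z)"

definition cantor_outer_second_deriv :: "complex \<Rightarrow> complex" where
  "cantor_outer_second_deriv z = ((cantor_potential 1 z)\<^sup>2 - cantor_potential 2 z) * cantor_outer z"

lemma cantor_outer_derivative:
  assumes "cmod z < 1"
  shows "(cantor_outer has_field_derivative - cantor_potential 1 z * cantor_outer z) (at z)"
  unfolding cantor_outer_def[abs_def]
  using cantor_potential_derivative[OF assms, of 0]
  by (auto intro!: derivative_eq_intros)

lemma cantor_outer_derivative2:
  assumes "cmod z < 1"
  shows "((\<lambda>z. - cantor_potential 1 z * cantor_outer z) has_field_derivative cantor_outer_second_deriv z) (at z)"
proof -
  have "((\<lambda>z. - cantor_potential 1 z * cantor_outer z) has_field_derivative
      (- cantor_potential 2 z * cantor_outer z + - cantor_potential 1 z * cantor_outer z * - cantor_potential 1 z)) (at z)"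
    using DERIV_mult[OF DERIV_minus[OF cantor_potential_derivative[OF assms, of 1]] cantor_outer_derivative[OF assms]]
    by (simp add: numeral_2_eq_2 mult_ac)
  then show ?thesis by (simp add: cantor_outer_second_deriv_def power2_eq_square algebra_simps)
qed

text \<open>
  The derivatives of the potential contribute at most \<open>99 / d\<^sup>4\<close>, where \<open>d \<le> 1\<close> is the distance to the Cantor set.
  If \<open>3\<^bsup>-(k+1)\<^esup> < d \<le> 3\<^bsup>-k\<^esup>\<close> this is at most \<open>99 * 81\<^bsup>k+1\<^esup>\<close>, while \<open>\<bar>exp(-G)\<bar> \<le> exp(-(4/3)\<^sup>k / 49)\<close>, which is at
  most \<open>784\<^bsup>16\<^esup> / 81\<^sup>k\<close> with \<open>784 = 49 * 16\<close>.
\<close>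

lemma norm_cantor_outer_second_deriv_le:
  assumes z: "cmod z < 1"
  shows "cmod (cantor_outer_second_deriv z) \<le> 99 * 81 * 784 ^ 16"
proof -
  obtain d B where d: "d > 0" and far: "\<And>A. finite A \<Longrightarrow> d \<le> cmod (z - cantor_point A)"
    and B: "finite B" "cmod (z - cantor_point B) < 2 * d"
    using cantor_distance[OF z] by blast
  have fz: "cmod (cantor_outer z) = exp (- Re (cantor_potential 0 z))"
    by (simp add: cantor_outer_def)
  have P1: "cmod (cantor_potential 1 z) \<le> 9 / d\<^sup>2"
    using norm_cantor_potential_le[OF z d far, of 1] by (simp add: power2_eq_square)
  have P2: "cmod (cantor_potential 2 z) \<le> 18 / d ^ 3"
    using norm_cantor_potential_le[OF z d far, of 2] by (simp add: power2_eq_square power3_eq_cube)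
  have sum: "cmod ((cantor_potential 1 z)\<^sup>2 - cantor_potential 2 z) \<le> 81 / d ^ 4 + 18 / d ^ 3"
  proof -
    have "cmod ((cantor_potential 1 z)\<^sup>2 - cantor_potential 2 z)
        \<le> (cmod (cantor_potential 1 z))\<^sup>2 + cmod (cantor_potential 2 z)"
      using norm_triangle_ineq4[of "(cantor_potential 1 z)\<^sup>2"] by (simp add: norm_power)
    also have "\<dots> \<le> (9 / d\<^sup>2)\<^sup>2 + 18 / d ^ 3"
      by (intro add_mono power_mono P1 P2) simp
    also have "(9 / d\<^sup>2)\<^sup>2 = 81 / d ^ 4" by (simp add: power_divide power_mult[symmetric])
    finally show ?thesis .
  qed
  show ?thesis
  proof (cases "d \<le> 1")
    case False
    have "Re (cantor_potential 0 z) \<ge> 0"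
      using Re_cantor_potential_ge[OF z, of 0] Re_cantor_kernel_nonneg[of z 0] z by simp
    then have "cmod (cantor_outer z) \<le> 1" by (simp add: fz)
    moreover have "81 / d ^ 4 + 18 / d ^ 3 \<le> 81 / 1 + 18 / 1"
      using False by (intro add_mono divide_left_mono) auto
    ultimately have "cmod (cantor_outer_second_deriv z) \<le> 99 * 1"
      unfolding cantor_outer_second_deriv_def norm_mult using sum by (intro mult_mono) auto
    then show ?thesis by (rule order_trans) simp
  next
    case True
    define n where "n = (LEAST n. (1/3) ^ n < d)"
    have n: "(1/3) ^ n < d" unfolding n_def
      using real_arch_pow_inv[OF d, of "1/3"] by (rule exE) (auto intro: LeastI)
    have "n \<noteq> 0" using n True by (intro notI) simp
    then obtain k where k: "n = Suc k" by (cases n) auto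
    have dk: "d \<le> (1/3) ^ k"
      using not_less_Least[of k "\<lambda>n. (1/3) ^ n < d"] k unfolding n_def[symmetric] by simp
    define y :: real where "y = (4/3) ^ k / 49"
    have "cmod (cantor_outer z) \<le> exp (- y)"
      unfolding fz y_def using Re_cantor_potential_near[OF z B dk] by simp
    also have "\<dots> \<le> 784 ^ 16 / 81 ^ k"
    proof -
      have "(81::real) ^ k \<le> ((4/3) ^ 16) ^ k" by (rule power_mono) (simp_all add: power_divide)
      also have "\<dots> = ((4/3) ^ k) ^ 16" by (simp only: power_mult[symmetric] mult.commute)
      also have "\<dots> = 784 ^ 16 * (y / 16) ^ 16"
        unfolding y_def power_mult_distrib[symmetric] by (rule arg_cong[where f = "\<lambda>x. x ^ 16"]) simp
      finally have "exp (- y) * 81 ^ k \<le> exp (- y) * (784 ^ 16 * (y / 16) ^ 16)"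
        by (rule mult_left_mono) simp
      also have "\<dots> = 784 ^ 16 * (exp (- y) * (y / 16) ^ 16)" by (simp only: mult_ac)
      also have "\<dots> \<le> 784 ^ 16 * 1"
        by (rule mult_left_mono[OF exp_neg_power_le]) (simp_all add: y_def)
      finally show ?thesis by (simp only: pos_le_divide_eq zero_less_power zero_less_numeral mult_1_right)
    qed
    finally have f: "cmod (cantor_outer z) \<le> 784 ^ 16 / 81 ^ k" .
    have "1 / d ^ 3 \<le> 1 / d ^ 4"
      using d True by (intro divide_left_mono power_decreasing mult_pos_pos zero_less_power) auto
    then have "81 / d ^ 4 + 18 / d ^ 3 \<le> 99 * (1 / d ^ 4)" by (simp add: field_simps)
    also have "1 / d ^ 4 \<le> 1 / ((1/3) ^ n) ^ 4"
      using n by (intro divide_left_mono power_mono mult_pos_pos zero_less_power d) auto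
    also have "1 / ((1/3 :: real) ^ n) ^ 4 = 81 * 81 ^ k"
    proof -
      have "((1/3 :: real) ^ n) ^ 4 = ((1/3) ^ 4) ^ n" by (simp only: power_mult[symmetric] mult.commute)
      also have "(1/3 :: real) ^ 4 = 1 / 81" by (simp add: power_divide)
      finally show ?thesis by (simp add: k power_divide)
    qed
    finally have "cmod ((cantor_potential 1 z)\<^sup>2 - cantor_potential 2 z) \<le> 99 * (81 * 81 ^ k)"
      using sum by simp
    with f have "cmod (cantor_outer_second_deriv z) \<le> 99 * (81 * 81 ^ k) * (784 ^ 16 / 81 ^ k)"
      unfolding cantor_outer_second_deriv_def norm_mult by (intro mult_mono) auto
    also have "\<dots> = 99 * 81 * 784 ^ 16" by simp
    finally show ?thesis .
  qed
qed

definition cantor_coeff :: "nat \<Rightarrow> complex" where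
  "cantor_coeff n = (deriv ^^ n) cantor_outer 0 / fact n"

lemma cantor_outer_holomorphic: "cantor_outer holomorphic_on ball 0 1"
  unfolding holomorphic_on_open[OF open_ball]
  by (intro ballI exI, rule cantor_outer_derivative) simp

lemma cantor_outer_sums:
  assumes "l \<in> ball 0 1"
  shows "(\<lambda>n. cantor_coeff n * l ^ n) sums cantor_outer l"
  using holomorphic_power_series[OF cantor_outer_holomorphic assms]
  by (simp add: cantor_coeff_def)

text \<open>
  Cauchy's inequality for the bounded second derivative, on circles of radius tending to \<open>1\<close>.
\<close>

lemma norm_cantor_coeff_le:
  obtains C where "C > 0" "\<And>n. cmod (cantor_coeff (n + 2)) \<le> C / ((real n + 1) * (real n + 2))"
proof
  define C :: real where "C = 99 * 81 * 784 ^ 16"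
  show "C > 0" by (simp add: C_def)
  fix n
  define h where "h = deriv (deriv cantor_outer)"
  have h: "h z = cantor_outer_second_deriv z" if z: "z \<in> ball 0 1" for z
  proof -
    have d1: "deriv cantor_outer x = - cantor_potential 1 x * cantor_outer x" if "x \<in> ball 0 1" for x
      using that by (intro DERIV_imp_deriv cantor_outer_derivative) simp
    have "(deriv cantor_outer has_field_derivative cantor_outer_second_deriv z) (at z)"
      by (rule has_field_derivative_transform_within_open[OF cantor_outer_derivative2, of z "ball 0 1"])
         (use z d1 in auto)
    then show ?thesis unfolding h_def by (rule DERIV_imp_deriv)
  qed
  have hol: "h holomorphic_on ball 0 1"
    unfolding h_def by (intro holomorphic_deriv cantor_outer_holomorphic) auto
  have "cmod ((deriv ^^ n) h 0) * r ^ n \<le> fact n * C" if r: "0 < r" "r < 1" for r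
  proof -
    have sub: "cball 0 r \<subseteq> (ball 0 1 :: complex set)" using r by auto
    have "cmod ((deriv ^^ n) h 0) \<le> fact n * C / r ^ n"
    proof (rule Cauchy_inequality)
      show "h holomorphic_on ball 0 r" using hol by (rule holomorphic_on_subset) (use r in auto)
      show "continuous_on (cball 0 r) h"
        using holomorphic_on_imp_continuous_on[OF hol] sub by (rule continuous_on_subset)
      show "cmod (h x) \<le> C" if "cmod (0 - x) = r" for x
        using that r h[of x] norm_cantor_outer_second_deriv_le[of x] by (simp add: C_def)
    qed (use r in auto)
    then show ?thesis using r by (simp add: pos_le_divide_eq)
  qed
  then have "cmod ((deriv ^^ n) h 0) * 1 ^ n \<le> fact n * C"
  proof (intro tendsto_upperbound[where F = "at_left (1::real)" and f = "\<lambda>r. cmod ((deriv ^^ n) h 0) * r ^ n"])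
    show "((\<lambda>r. cmod ((deriv ^^ n) h 0) * r ^ n) \<longlongrightarrow> cmod ((deriv ^^ n) h 0) * 1 ^ n) (at_left 1)"
      by (intro tendsto_intros)
    assume *: "\<And>r. 0 < r \<Longrightarrow> r < 1 \<Longrightarrow> cmod ((deriv ^^ n) h 0) * r ^ n \<le> fact n * C"
    have "\<forall>\<^sub>F r in at_left (1::real). r \<in> {0<..<1}" by (rule eventually_at_leftI[of 0]) auto
    then show "\<forall>\<^sub>F r in at_left 1. cmod ((deriv ^^ n) h 0) * r ^ n \<le> fact n * C"
      by eventually_elim (use * in auto)
  qed auto
  moreover have "(deriv ^^ (n + 2)) cantor_outer 0 = (deriv ^^ n) h 0"
    unfolding h_def funpow_add by (simp add: numeral_2_eq_2)
  ultimately have "cmod ((deriv ^^ (n + 2)) cantor_outer 0) \<le> fact n * C" by simp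
  then have "cmod (cantor_coeff (n + 2)) \<le> fact n * C / fact (n + 2)"
    unfolding cantor_coeff_def norm_divide norm_fact by (rule divide_right_mono) simp
  also have "(fact (n + 2) :: real) = fact n * ((real n + 1) * (real n + 2))"
    by (simp add: numeral_2_eq_2 algebra_simps)
  finally show "cmod (cantor_coeff (n + 2)) \<le> C / ((real n + 1) * (real n + 2))" by simp
qed

lemma cantor_coeff_weighted_summable:
  "summable (\<lambda>i. cmod (cantor_coeff i) * (real i + 1) powr (1/4))"
proof -
  obtain C where C: "C > 0" and le: "\<And>n. cmod (cantor_coeff (n + 2)) \<le> C / ((real n + 1) * (real n + 2))"
    using norm_cantor_coeff_le by blast
  have "summable (\<lambda>n. cmod (cantor_coeff (n + 2)) * (real (n + 2) + 1) powr (1/4))"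
  proof (rule summable_comparison_test')
    show "summable (\<lambda>n. 3 * C * real (Suc n) powr (- 7/4))"
      using summable_real_powr_iff[of "- 7/4"] by (intro summable_mult) (subst summable_Suc_iff, simp)
    fix n :: nat
    let ?x = "real n + 1"
    have "(real (n + 2) + 1) powr (1/4) \<le> (3 * ?x) powr (1/4)"
      by (rule powr_mono2) auto
    also have "\<dots> = 3 powr (1/4) * ?x powr (1/4)" by (rule powr_mult)
    also have "\<dots> \<le> 3 powr 1 * ?x powr (1/4)"
      by (intro mult_right_mono powr_mono) auto
    finally have p: "(real (n + 2) + 1) powr (1/4) \<le> 3 * ?x powr (1/4)" by simp
    have "C / (?x * (real n + 2)) \<le> C / (?x * ?x)"
      using C by (intro divide_left_mono mult_left_mono mult_pos_pos) auto
    with le[of n] have "cmod (cantor_coeff (n + 2)) \<le> C / (?x * ?x)" by simp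
    also have "\<dots> = C * ?x powr (- 2)" by (simp add: powr_minus power2_eq_square divide_inverse)
    finally have "cmod (cantor_coeff (n + 2)) * (real (n + 2) + 1) powr (1/4)
        \<le> (C * ?x powr (- 2)) * (3 * ?x powr (1/4))"
      using p C by (intro mult_mono) auto
    also have "\<dots> = 3 * C * (?x powr (- 2) * ?x powr (1/4))" by (simp only: mult_ac)
    also have "?x powr (- 2) * ?x powr (1/4) = ?x powr (- 7/4)" by (simp flip: powr_add)
    finally show "norm (cmod (cantor_coeff (n + 2)) * (real (n + 2) + 1) powr (1/4)) \<le> 3 * C * real (Suc n) powr (- 7/4)"
      by (simp add: add.commute)
  qed
  then show ?thesis
    using summable_iff_shift[of "\<lambda>i. cmod (cantor_coeff i) * (real i + 1) powr (1/4)" 2] by simp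
qed

lemma cantor_coeff_summable: "summable (\<lambda>i. cmod (cantor_coeff i))"
proof (rule summable_comparison_test'[OF cantor_coeff_weighted_summable])
  fix i :: nat
  have "cmod (cantor_coeff i) * 1 \<le> cmod (cantor_coeff i) * (real i + 1) powr (1/4)"
    by (intro mult_left_mono ge_one_powr_ge_zero) auto
  then show "norm (cmod (cantor_coeff i)) \<le> cmod (cantor_coeff i) * (real i + 1) powr (1/4)" by simp
qed

lemma diag_weight_2_le: "diag_weight 2 m \<le> real m + 1"
proof (induction m)
  case 0
  then show ?case by (simp add: diag_weight_def)
next
  case (Suc m)
  have "diag_weight 2 (Suc m) * (2 * real m + 1) = diag_weight 2 m * (2 * (real m + 1))"
    using diag_weight_Suc[of 2 m] by simp
  also have "\<dots> \<le> (real m + 1) * (2 * (real m + 1))"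
    using Suc by (intro mult_right_mono) auto
  also have "\<dots> \<le> (real m + 2) * (2 * real m + 1)" by (simp add: algebra_simps)
  finally have "diag_weight 2 (Suc m) \<le> real m + 2" by (rule mult_right_le_imp_le) simp
  then show ?case by simp
qed

lemma cantor_coeff_DA_summable: "summable (\<lambda>m. diag_weight 2 m * (cmod (cantor_coeff m))\<^sup>2)"
proof -
  obtain C where C: "C > 0" and le: "\<And>n. cmod (cantor_coeff (n + 2)) \<le> C / ((real n + 1) * (real n + 2))"
    using norm_cantor_coeff_le by blast
  have "summable (\<lambda>n. diag_weight 2 (n + 2) * (cmod (cantor_coeff (n + 2)))\<^sup>2)"
  proof (rule summable_comparison_test')
    show "summable (\<lambda>n. C\<^sup>2 * (1 / (real (Suc n))\<^sup>2))"
      using inverse_power_summable[of 2, where ?'a = real]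
      by (intro summable_mult) (subst summable_Suc_iff[of "\<lambda>n. 1 / (real n)\<^sup>2"], simp add: divide_inverse)
    fix n :: nat
    define x where "x = real n + 1"
    have x: "x \<ge> 1" by (simp add: x_def)
    have w: "diag_weight 2 (n + 2) \<ge> 0" by (simp add: diag_weight_def)
    have "diag_weight 2 (n + 2) * (cmod (cantor_coeff (n + 2)))\<^sup>2 \<le> (x + 2) * (C / (x * (x + 1)))\<^sup>2"
    proof (intro mult_mono power_mono)
      show "diag_weight 2 (n + 2) \<le> x + 2" using diag_weight_2_le[of "n + 2"] by (simp add: x_def)
      show "cmod (cantor_coeff (n + 2)) \<le> C / (x * (x + 1))" using le[of n] by (simp add: x_def add.commute)
    qed (use x in auto)
    also have "\<dots> = C\<^sup>2 / x\<^sup>2 * ((x + 2) / (x + 1)\<^sup>2)" by (simp add: power_divide power_mult_distrib)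
    also have "\<dots> \<le> C\<^sup>2 / x\<^sup>2 * 1"
    proof (rule mult_left_mono)
      have "x + 2 \<le> (x + 1)\<^sup>2" 
      proof -
        have "(x + 1)\<^sup>2 = x * x + 2 * x + 1" by (simp add: power2_eq_square algebra_simps)
        moreover have "x * x \<ge> 0" by simp
        ultimately show ?thesis using x by linarith
      qed
      then show "(x + 2) / (x + 1)\<^sup>2 \<le> 1" using x by simp
    qed simp
    finally show "norm (diag_weight 2 (n + 2) * (cmod (cantor_coeff (n + 2)))\<^sup>2) \<le> C\<^sup>2 * (1 / (real (Suc n))\<^sup>2)"
      using w by (simp add: x_def add.commute)
  qed
  then show ?thesis using summable_iff_shift[of "\<lambda>m. diag_weight 2 m * (cmod (cantor_coeff m))\<^sup>2" 2] by simp
qed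

text \<open>
  Along the radius to \<open>cantor_point B\<close> the summand of level \<open>K\<close> with that pole is real and tends to
  \<open>(4/9)\<^sup>K 3\<^sup>K\<close>.  The sum on the left is the radial limit, because the coefficients are absolutely summable.
\<close>

lemma cantor_outer_boundary_small:
  assumes B: "B \<subseteq> {..<K}"
  shows "cmod (\<Sum>i. cantor_coeff i * cantor_point B ^ i) \<le> exp (- ((4/3) ^ K))"
proof -
  define F where "F z = (\<Sum>i. cantor_coeff i * z ^ i)" for z
  have cont: "continuous_on (cball 0 1) F"
  proof -
    have "uniform_limit (cball 0 1) (\<lambda>n z. \<Sum>i<n. cantor_coeff i * z ^ i) F sequentially"
      unfolding F_def
    proof (rule Weierstrass_m_test[OF _ cantor_coeff_summable])
      fix n and z :: complex assume "z \<in> cball 0 1"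
      then have "cmod z ^ n \<le> 1" by (simp add: power_le_one)
      then show "norm (cantor_coeff n * z ^ n) \<le> cmod (cantor_coeff n)"
        by (simp add: norm_mult norm_power mult_left_le)
    qed
    then show ?thesis
      by (rule uniform_limit_theorem[rotated]) (auto intro!: always_eventually continuous_intros)
  qed
  define z where "z r = complex_of_real r * cantor_point B" for r
  have lim: "((\<lambda>r. cmod (F (z r))) \<longlongrightarrow> cmod (F (cantor_point B))) (at_left 1)"
  proof (rule tendsto_norm, rule continuous_on_tendsto_compose[OF cont])
    have "(z \<longlongrightarrow> of_real 1 * cantor_point B) (at_left 1)" unfolding z_def by (intro tendsto_intros)
    then show "(z \<longlongrightarrow> cantor_point B) (at_left 1)" by simp
    have "\<forall>\<^sub>F r in at_left (1::real). r \<in> {0<..<1}" by (rule eventually_at_leftI[of 0]) auto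
    then show "\<forall>\<^sub>F r in at_left 1. z r \<in> cball 0 1" by eventually_elim (auto simp: z_def norm_mult)
  qed simp
  have lim2: "((\<lambda>r. exp (- ((4/9) ^ K * inverse (1 + (1/3) ^ K - r)))) \<longlongrightarrow> 
      exp (- ((4/9) ^ K * inverse (1 + (1/3) ^ K - 1)))) (at_left (1::real))"
    by (intro tendsto_intros) simp
  have "cmod (F (cantor_point B)) \<le> exp (- ((4/9) ^ K * inverse (1 + (1/3) ^ K - 1)))"
  proof (rule tendsto_le[OF _ lim2 lim])
    have "\<forall>\<^sub>F r in at_left (1::real). r \<in> {0<..<1}" by (rule eventually_at_leftI[of 0]) auto
    then show "\<forall>\<^sub>F r in at_left 1. cmod (F (z r)) \<le> exp (- ((4/9) ^ K * inverse (1 + (1/3) ^ K - r)))"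
    proof eventually_elim
      case (elim r)
      have zr: "cmod (z r) < 1" using elim by (simp add: z_def norm_mult)
      have "F (z r) = cantor_outer (z r)"
        using cantor_outer_sums[of "z r"] zr by (simp add: F_def sums_iff)
      then have "cmod (F (z r)) = exp (- Re (cantor_potential 0 (z r)))" by (simp add: cantor_outer_def)
      moreover have "Re (cantor_potential 0 (z r)) \<ge> (4/9) ^ K * inverse (1 + (1/3) ^ K - r)"
      proof -
        have unit: "cantor_point B * cnj (cantor_point B) = 1"
          using complex_norm_square[of "cantor_point B"] by simp
        have "z r * cnj (cantor_point B) = of_real r" unfolding z_def mult.assoc unit by simp
        then have "of_real (1 + (1/3) ^ K) - z r * cnj (cantor_point B) = complex_of_real (1 + (1/3) ^ K - r)"
          by simp
        then have "Re (inverse (of_real (1 + (1/3) ^ K) - z r * cnj (cantor_point B))) = inverse (1 + (1/3) ^ K - r)"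
          by (simp only: of_real_inverse[symmetric] Re_complex_of_real)
        then have "inverse (1 + (1/3) ^ K - r) \<le> Re (cantor_kernel 0 K (z r))"
          using Re_cantor_kernel_ge[of "z r" B K] zr B by simp
        then have "(4/9) ^ K * inverse (1 + (1/3) ^ K - r) \<le> (4/9) ^ K * Re (cantor_kernel 0 K (z r))"
          by (rule mult_left_mono) simp
        also have "\<dots> \<le> Re (cantor_potential 0 (z r))" by (rule Re_cantor_potential_ge[OF zr])
        finally show ?thesis .
      qed
      ultimately show ?case by simp
    qed
  qed simp
  also have "(4/9 :: real) ^ K * inverse (1 + (1/3) ^ K - 1) = (4/3) ^ K"
  proof -
    have "inverse (1 + (1/3 :: real) ^ K - 1) = 3 ^ K" by (simp add: power_divide)
    then show ?thesis by (simp only: power_mult_distrib[symmetric]) simp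
  qed
  finally show ?thesis by (simp add: F_def)
qed

text \<open>
  The sum is the integral of \<open>\<zeta>\<^sup>j f(\<zeta>)\<close> against the Cantor measure, and \<open>f\<close> vanishes on its support.  For the
  \<open>K\<close>-th approximating measure the integrand is at most \<open>exp(-(4/3)\<^sup>K)\<close>; Tannery's theorem gives the limit in \<open>K\<close>.
\<close>

lemma cantor_outer_annihilated: "(\<lambda>i. cantor_coeff i * cantor_limit (i + j)) sums 0"
proof -
  have avg: "cmod (\<Sum>i. cantor_coeff i * cantor_moment K (i + j)) \<le> exp (- ((4/3) ^ K))" for K
  proof -
    let ?P = "Pow {..<K}"
    have s: "summable (\<lambda>i. cantor_coeff i * cantor_point A ^ i)" for A
      by (rule summable_norm_cancel) (simp add: norm_mult norm_power cantor_coeff_summable)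
    have "(\<lambda>i. \<Sum>A\<in>?P. cantor_point A ^ j * (cantor_coeff i * cantor_point A ^ i) / 2 ^ K)
        sums (\<Sum>A\<in>?P. cantor_point A ^ j * (\<Sum>i. cantor_coeff i * cantor_point A ^ i) / 2 ^ K)"
      by (intro sums_sum sums_divide sums_mult summable_sums s)
    moreover have "(\<Sum>A\<in>?P. cantor_point A ^ j * (cantor_coeff i * cantor_point A ^ i) / 2 ^ K)
        = cantor_coeff i * cantor_moment K (i + j)" for i
      unfolding cantor_moment_eq_average
      by (simp add: sum_divide_distrib sum_distrib_left power_add mult_ac)
    ultimately have "(\<Sum>i. cantor_coeff i * cantor_moment K (i + j)) 
        = (\<Sum>A\<in>?P. cantor_point A ^ j * (\<Sum>i. cantor_coeff i * cantor_point A ^ i) / 2 ^ K)"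
      by (simp add: sums_iff)
    also have "cmod \<dots> \<le> (\<Sum>A\<in>?P. exp (- ((4/3) ^ K)) / 2 ^ K)"
    proof (rule sum_norm_le)
      fix A assume "A \<in> ?P"
      then show "cmod (cantor_point A ^ j * (\<Sum>i. cantor_coeff i * cantor_point A ^ i) / 2 ^ K) \<le> exp (- ((4/3) ^ K)) / 2 ^ K"
        using cantor_outer_boundary_small[of A K] 
        by (simp add: norm_mult norm_divide norm_power divide_right_mono)
    qed
    also have "\<dots> = exp (- ((4/3) ^ K))" by (simp add: card_Pow)
    finally show ?thesis .
  qed
  have small: "exp (- ((4/3 :: real) ^ K)) \<le> (3/4) ^ K" for K
  proof -
    have "(4/3 :: real) ^ K \<le> exp ((4/3) ^ K)" using exp_ge_add_one_self[of "(4/3 :: real) ^ K"] by linarith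
    then have "inverse (exp ((4/3 :: real) ^ K)) \<le> inverse ((4/3) ^ K)"
      by (rule le_imp_inverse_le) simp
    moreover have "inverse ((4/3 :: real) ^ K) = (3/4) ^ K" by (simp only: power_inverse[symmetric]) simp
    ultimately show ?thesis by (simp only: exp_minus)
  qed
  have bound: "norm (\<Sum>i. cantor_coeff i * cantor_moment K (i + j)) \<le> (3/4) ^ K" for K
    by (rule order_trans[OF avg small])
  have "(\<lambda>K. (3/4 :: real) ^ K) \<longlonglongrightarrow> 0" by (rule LIMSEQ_realpow_zero) simp_all
  then have "(\<lambda>K. \<Sum>i. cantor_coeff i * cantor_moment K (i + j)) \<longlonglongrightarrow> 0"
    by (rule Lim_null_comparison[OF always_eventually[OF allI[OF bound]]])
  moreover have "(\<lambda>K. \<Sum>i. cantor_coeff i * cantor_moment K (i + j)) \<longlonglongrightarrow> (\<Sum>i. cantor_coeff i * cantor_limit (i + j))"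
  proof (rule tannerys_theorem[where M = "\<lambda>i. cmod (cantor_coeff i)", THEN conjunct2, THEN conjunct2])
    show "\<forall>\<^sub>F (i, K) in at_top \<times>\<^sub>F sequentially. norm (cantor_coeff i * cantor_moment K (i + j)) \<le> cmod (cantor_coeff i)"
      by (rule always_eventually) (auto simp: norm_mult intro!: mult_left_le norm_cantor_moment_le_1)
    show "((\<lambda>K. cantor_coeff i * cantor_moment K (i + j)) \<longlongrightarrow> cantor_coeff i * cantor_limit (i + j)) sequentially" for i
      by (intro tendsto_intros cantor_moment_tendsto)
  qed (auto simp: cantor_coeff_summable)
  ultimately have "(\<Sum>i. cantor_coeff i * cantor_limit (i + j)) = 0" using LIMSEQ_unique by blast
  moreover have "summable (\<lambda>i. cantor_coeff i * cantor_limit (i + j))"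
  proof (rule summable_comparison_test'[OF cantor_coeff_summable])
    fix i
    have "cmod (cantor_limit (i + j)) \<le> 1"
      using norm_cantor_limit_le[of "i + j" 0] norm_cantor_moment_le_1[of 0 "i + j"] by simp
    then show "norm (cantor_coeff i * cantor_limit (i + j)) \<le> cmod (cantor_coeff i)"
      by (simp add: norm_mult mult_left_le)
  qed
  ultimately show ?thesis using summable_sums by fastforce
qed

section \<open>Outer functions as exponentials of series\<close>

lemma circle_mean_value:
  fixes h :: "complex \<Rightarrow> complex"
  assumes c: "continuous_on (cball 0 1) h" and h: "h holomorphic_on ball 0 1" and l: "cmod l < 1"
  shows "((\<lambda>t. cis t * h (cis t) / (cis t - l)) has_integral (2 * pi * h l)) {0..2*pi}"
proof -
  have "((\<lambda>u. h u / (u - l)) has_contour_integral (2 * of_real pi * \<i> * h l)) (circlepath 0 1)"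
    by (rule Cauchy_integral_circlepath[OF c h]) (use l in simp)
  then have "((\<lambda>t. h (cis t) / (cis t - l) * \<i> * cis t) has_integral (2 * of_real pi * \<i> * h l)) {0..2*pi}"
    unfolding circlepath_def by (subst (asm) has_contour_integral_part_circlepath_iff) (auto simp: mult_ac)
  then have "((\<lambda>t. - \<i> * (h (cis t) / (cis t - l) * \<i> * cis t)) has_integral (- \<i> * (2 * of_real pi * \<i> * h l))) {0..2*pi}"
    by (rule has_integral_mult_right)
  then show ?thesis by (simp add: mult_ac)
qed

lemma cis_minus_interior_nonzero: "cmod l < 1 \<Longrightarrow> cis t - l \<noteq> 0"
  by auto

text \<open>
  With \<open>w = cis t\<close>, Cauchy's formula gives \<open>2 h(l) - h(0)\<close> for the mean of \<open>(w + l) / (w - l) h(w)\<close>.  On the circle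
  the conjugate of the kernel is \<open>(1 + l\<^sup>* w) / (1 - l\<^sup>* w)\<close>, holomorphic in the disc, so the mean of the kernel times
  the conjugate of \<open>h\<close> is the conjugate of \<open>h(0)\<close>.  The formula is half the sum of
  the two, since \<open>h(0)\<close> is real.
\<close>

lemma Schwarz_integral_formula:
  fixes h :: "complex \<Rightarrow> complex"
  assumes c: "continuous_on (cball 0 1) h" and h: "h holomorphic_on ball 0 1"
    and im: "Im (h 0) = 0" and l: "cmod l < 1"
  shows "((\<lambda>t. (cis t + l) / (cis t - l) * of_real (Re (h (cis t)))) has_integral (2 * pi * h l)) {0..2*pi}"
proof -
  have 0: "((\<lambda>t. h (cis t)) has_integral (2 * pi * h 0)) {0..2*pi}"
    using circle_mean_value[OF c h, of 0] by simp
  have "((\<lambda>t. 2 * (cis t * h (cis t) / (cis t - l)) - h (cis t)) has_integral 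
      (2 * (2 * pi * h l) - 2 * pi * h 0)) {0..2*pi}"
    by (intro has_integral_diff has_integral_mult_right circle_mean_value[OF c h l] 0)
  moreover have "2 * (cis t * h (cis t) / (cis t - l)) - h (cis t) = (cis t + l) / (cis t - l) * h (cis t)" for t
  proof -
    have "2 * (c * x / d) - x = (2 * c - d) / d * x" if "d \<noteq> 0" for c d x :: complex
      using that by (simp add: diff_divide_distrib left_diff_distrib)
    from this[OF cis_minus_interior_nonzero[OF l, of t]] show ?thesis by simp
  qed
  ultimately have 1: "((\<lambda>t. (cis t + l) / (cis t - l) * h (cis t)) has_integral 
      (2 * (2 * pi * h l) - 2 * pi * h 0)) {0..2*pi}" by simp
  \<comment> \<open>On the circle the conjugate of \<open>K\<close> is the Schwarz kernel times the conjugate of \<open>h\<close>.\<close>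
  define K where "K w = (1 + cnj l * w) / (1 - cnj l * w) * h w" for w
  have ne: "1 - cnj l * w \<noteq> 0" if "cmod w \<le> 1" for w
  proof
    assume "1 - cnj l * w = 0"
    then have "cmod (cnj l * w) = 1" by simp
    moreover have "cmod l * cmod w \<le> cmod l" using that by (simp add: mult_left_le)
    ultimately show False using l by (simp add: norm_mult)
  qed
  have "continuous_on (cball 0 1) K" "K holomorphic_on ball 0 1" unfolding K_def
    using ne by (auto intro!: continuous_intros holomorphic_intros c h simp: less_imp_le)
  from circle_mean_value[OF this, of 0] have "((\<lambda>t. K (cis t)) has_integral (2 * pi * h 0)) {0..2*pi}"
    by (simp add: K_def)
  from has_integral_linear[OF this bounded_linear_cnj]
  have "((\<lambda>t. cnj (K (cis t))) has_integral (2 * pi * cnj (h 0))) {0..2*pi}" by (simp add: o_def)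
  moreover have "cnj (K (cis t)) = (cis t + l) / (cis t - l) * cnj (h (cis t))" for t
  proof -
    have "cnj ((1 + cnj l * cis t) / (1 - cnj l * cis t)) = (1 + l * inverse (cis t)) / (1 - l * inverse (cis t))"
      by (simp add: cis_cnj cis_inverse)
    also have "\<dots> = (cis t + l) / (cis t - l)"
    proof -
      have "(1 + l * inverse (cis t)) * cis t = cis t + l" "(1 - l * inverse (cis t)) * cis t = cis t - l"
        by (simp_all add: distrib_right left_diff_distrib mult.assoc del: cis_inverse)
      then show ?thesis by (metis cis_neq_zero mult_divide_mult_cancel_right)
    qed
    finally show ?thesis unfolding K_def complex_cnj_mult by (rule arg_cong)
  qed
  ultimately have 2: "((\<lambda>t. (cis t + l) / (cis t - l) * cnj (h (cis t))) has_integral (2 * pi * cnj (h 0))) {0..2*pi}"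
    by simp
  have "((\<lambda>t. ((cis t + l) / (cis t - l) * h (cis t) + (cis t + l) / (cis t - l) * cnj (h (cis t))) / 2)
      has_integral ((2 * (2 * pi * h l) - 2 * pi * h 0) + 2 * pi * cnj (h 0)) / 2) {0..2*pi}"
    by (intro has_integral_divide has_integral_add 1 2)
  moreover have "((2 * (2 * pi * h l) - 2 * pi * h 0) + 2 * pi * cnj (h 0)) / 2 = 2 * pi * h l"
  proof -
    have "cnj (h 0) = h 0" using im by (simp add: complex_eq_iff)
    then show ?thesis by simp
  qed
  moreover have "(s * w + s * cnj w) / 2 = s * of_real (Re w)" for s w :: complex
    using complex_add_cnj[of w] by (simp add: distrib_left[symmetric])
  ultimately show ?thesis by (simp only:)
qed

lemma continuous_on_Schwarz_kernel:
  "cmod l < 1 \<Longrightarrow> continuous_on A (\<lambda>t. (cis t + l) / (cis t - l))"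
  by (intro continuous_intros) (auto simp: cis_minus_interior_nonzero)

lemma norm_Schwarz_kernel_le:
  assumes "cmod l < 1"
  shows "cmod ((cis t + l) / (cis t - l)) \<le> 2 / (1 - cmod l)"
proof -
  have "cmod (cis t + l) \<le> 2" using norm_triangle_ineq[of "cis t" l] assms by simp
  moreover have "cmod (cis t - l) \<ge> 1 - cmod l" using norm_triangle_ineq2[of "cis t" l] by simp
  ultimately show ?thesis unfolding norm_divide using assms by (intro frac_le) auto
qed

text \<open>
  The boundary functions \<open>Re (h k)\<close> are nonnegative and their integrals \<open>2 \<pi> Re (h k 0)\<close> are summable.
  Hence their sum is integrable, in particular finite almost everywhere, and since the Schwarz kernel at a
  fixed \<open>l\<close> is bounded, the formula can be summed over \<open>k\<close>.  The sum is \<open>- ln \<psi>\<close>.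
\<close>

lemma outer_exp_neg_sum:
  fixes h :: "nat \<Rightarrow> complex \<Rightarrow> complex"
  assumes c: "\<And>k. continuous_on (cball 0 1) (h k)" and hol: "\<And>k. h k holomorphic_on ball 0 1"
    and pos: "\<And>k w. cmod w = 1 \<Longrightarrow> Re (h k w) \<ge> 0"
    and im: "\<And>k. Im (h k 0) = 0"
    and G: "\<And>l. cmod l < 1 \<Longrightarrow> (\<lambda>k. h k l) sums G l"
    and g: "\<And>l. cmod l < 1 \<Longrightarrow> g l = exp (- G l)"
    and hardy: "g \<in> hardy2"
  shows "outer_hardy2 g"
proof -
  define I where "I = {0..2*pi}"
  define u where "u k t = Re (h k (cis t))" for k t
  define v where "v k t = indicator I t * u k t" for k t
  define U where "U t = (\<Sum>k. u k t)" for t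
  have u0: "u k t \<ge> 0" for k t unfolding u_def by (rule pos) simp
  have v0: "v k t \<ge> 0" for k t by (simp add: v_def u0)
  have uc: "continuous_on A (u k)" for A k
    unfolding u_def by (intro continuous_intros continuous_on_compose2[OF c]) auto
  have umeas [measurable]: "u k \<in> borel_measurable lebesgue" for k
    using borel_measurable_continuous_onI[OF uc[of UNIV k]] by (simp add: measurable_completion)
  have Umeas [measurable]: "U \<in> borel_measurable lebesgue"
    unfolding U_def by measurable
  have Imeas [measurable]: "I \<in> sets lebesgue" by (simp add: I_def)
  have Smeas: "(\<lambda>t. (cis t + l) / (cis t - l)) \<in> borel_measurable lebesgue" if "cmod l < 1" for l
    using borel_measurable_continuous_onI[OF continuous_on_Schwarz_kernel[OF that, of UNIV]] 
    by (simp add: measurable_completion)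
  have SI: "set_integrable lebesgue I (\<lambda>t. (cis t + l) / (cis t - l) * of_real (u k t))"
     "(LINT t:I|lebesgue. (cis t + l) / (cis t - l) * of_real (u k t)) = 2 * pi * h k l"
    if l: "cmod l < 1" for k l
  proof -
    show *: "set_integrable lebesgue I (\<lambda>t. (cis t + l) / (cis t - l) * of_real (u k t))"
      unfolding I_def 
      by (rule absolutely_integrable_continuous_real)
         (intro continuous_on_mult continuous_on_Schwarz_kernel[OF l] continuous_on_of_real uc)
    show "(LINT t:I|lebesgue. (cis t + l) / (cis t - l) * of_real (u k t)) = 2 * pi * h k l"
      unfolding set_lebesgue_integral_eq_integral(2)[OF *] unfolding I_def u_def
      by (rule integral_unique[OF Schwarz_integral_formula[OF c hol im l]])
  qed
  have vI: "integrable lebesgue (v k)" for k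
    using absolutely_integrable_continuous_real[OF uc, of 0 "2*pi" k]
    by (simp add: set_integrable_def v_def[abs_def] I_def)
  have vint: "integral\<^sup>L lebesgue (v k) = 2 * pi * Re (h k 0)" for k
  proof -
    have "complex_of_real (integral\<^sup>L lebesgue (v k)) = (LINT t:I|lebesgue. (cis t + 0) / (cis t - 0) * of_real (u k t))"
      unfolding set_lebesgue_integral_def integral_complex_of_real[symmetric]
      by (intro Bochner_Integration.integral_cong) (auto simp: v_def indicator_def)
    also have "\<dots> = 2 * pi * h k 0" by (rule SI(2)) simp
    finally have "Re (complex_of_real (integral\<^sup>L lebesgue (v k))) = Re (2 * pi * h k 0)" by simp
    then show ?thesis by simp
  qed
  have sumint: "summable (\<lambda>k. integral\<^sup>L lebesgue (v k))"
    unfolding vint using sums_summable[OF sums_Re[OF G[of 0]]] by (intro summable_mult) simp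
  have vmeas [measurable]: "v k \<in> borel_measurable lebesgue" for k
    using vI by (rule borel_measurable_integrable)
  have ae: "AE t in lebesgue. summable (\<lambda>k. v k t)"
  proof -
    have i0: "0 \<le> integral\<^sup>L lebesgue (v k)" for k
      by (rule Bochner_Integration.integral_nonneg) (rule v0)
    have "(\<integral>\<^sup>+t. ennreal (v k t) \<partial>lebesgue) = ennreal (integral\<^sup>L lebesgue (v k))" for k
      by (rule nn_integral_eq_integral[OF vI]) (simp add: v0)
    then have "(\<integral>\<^sup>+t. (\<Sum>k. ennreal (v k t)) \<partial>lebesgue) = (\<Sum>k. ennreal (integral\<^sup>L lebesgue (v k)))"
      by (subst nn_integral_suminf) simp_all
    also have "\<dots> \<noteq> \<infinity>"
      using ennreal_suminf_neq_top[OF sumint i0] by simp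
    finally have "(\<integral>\<^sup>+t. (\<Sum>k. ennreal (v k t)) \<partial>lebesgue) \<noteq> \<infinity>" .
    then have "AE t in lebesgue. (\<Sum>k. ennreal (v k t)) \<noteq> \<infinity>"
      by (rule nn_integral_PInf_AE[rotated]) measurable
    then show ?thesis
    proof eventually_elim
      case (elim t)
      then show ?case by (intro summable_suminf_not_top[OF v0]) simp
    qed
  qed
  have indU: "indicator I t * U t = (\<Sum>k. v k t)" if "summable (\<lambda>k. v k t)" for t
    by (cases "t \<in> I") (auto simp: U_def v_def)
  have Uint: "set_integrable lebesgue I U"
  proof -
    have "integrable lebesgue (\<lambda>t. \<Sum>k. v k t)"
      by (rule integrable_suminf) (use vI ae v0 sumint in auto)
    moreover have "AE t in lebesgue. (\<Sum>k. v k t) = indicator I t * U t"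
      using ae by eventually_elim (rule indU[symmetric])
    moreover have "(\<lambda>t. indicator I t * U t) \<in> borel_measurable lebesgue" by measurable
    ultimately have "integrable lebesgue (\<lambda>t. indicator I t * U t)"
      using integrable_cong_AE_imp by blast
    then show ?thesis by (simp add: set_integrable_def)
  qed
  have main: "(LINT t:I|lebesgue. (cis t + l) / (cis t - l) * of_real (U t)) = 2 * pi * G l"
    if l: "cmod l < 1" for l
  proof -
    define S where "S t = (cis t + l) / (cis t - l)" for t
    have Sm [measurable]: "S \<in> borel_measurable lebesgue" using Smeas[OF l] by (simp add: S_def[abs_def])
    have Sle: "cmod (S t) \<le> 2 / (1 - cmod l)" for t unfolding S_def by (rule norm_Schwarz_kernel_le[OF l])
    have Sv: "indicat_real I t *\<^sub>R (S t * of_real (u k t)) = S t * of_real (v k t)" for k t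
      by (cases "t \<in> I") (simp_all add: v_def)
    have int: "integrable lebesgue (\<lambda>t. S t * of_real (v k t))" for k
      using SI(1)[OF l, of k] unfolding set_integrable_def S_def[symmetric] Sv .
    have val: "(LINT t|lebesgue. S t * of_real (v k t)) = 2 * pi * h k l" for k
      using SI(2)[OF l, of k] unfolding set_lebesgue_integral_def S_def[symmetric] Sv .
    have nle: "norm (S t * of_real (v k t)) \<le> 2 / (1 - cmod l) * v k t" for k t
      unfolding norm_mult using mult_right_mono[OF Sle v0] v0 by simp
    have ae2: "AE t in lebesgue. summable (\<lambda>k. norm (S t * of_real (v k t)))"
      using ae
    proof eventually_elim
      case (elim t)
      show ?case
        by (rule summable_comparison_test'[OF summable_mult[OF elim, of "2 / (1 - cmod l)"]]) (use nle in simp)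
    qed
    have sum2: "summable (\<lambda>k. LINT t|lebesgue. norm (S t * of_real (v k t)))"
    proof (rule summable_comparison_test'[OF summable_mult[OF sumint, of "2 / (1 - cmod l)"]])
      fix k
      have "(LINT t|lebesgue. norm (S t * of_real (v k t))) \<le> (LINT t|lebesgue. 2 / (1 - cmod l) * v k t)"
        by (intro integral_mono integrable_norm int integrable_mult_right vI nle)
      then show "norm (LINT t|lebesgue. norm (S t * of_real (v k t))) \<le> 2 / (1 - cmod l) * integral\<^sup>L lebesgue (v k)"
        by simp
    qed
    have "(LINT t:I|lebesgue. S t * of_real (U t)) = (LINT t|lebesgue. (\<Sum>k. S t * of_real (v k t)))"
      unfolding set_lebesgue_integral_def
    proof (rule integral_cong_AE)
      show "(\<lambda>t. \<Sum>k. S t * complex_of_real (v k t)) \<in> borel_measurable lebesgue"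
        by (rule borel_measurable_integrable[OF integrable_suminf[OF int ae2 sum2]])
      show "AE t in lebesgue. indicat_real I t *\<^sub>R (S t * complex_of_real (U t)) = (\<Sum>k. S t * complex_of_real (v k t))"
        using ae
      proof eventually_elim
        case (elim t)
        have "(\<Sum>k. S t * complex_of_real (v k t)) = S t * complex_of_real (\<Sum>k. v k t)"
          using elim by (simp add: suminf_mult suminf_of_real)
        also have "\<dots> = indicat_real I t *\<^sub>R (S t * complex_of_real (U t))"
          unfolding indU[OF elim, symmetric] by (simp add: scaleR_conv_of_real)
        finally show ?case by simp
      qed
    qed measurable
    also have "\<dots> = (\<Sum>k. LINT t|lebesgue. S t * of_real (v k t))"
      by (rule integral_suminf[OF int ae2 sum2])
    also have "\<dots> = 2 * pi * G l"
      unfolding val using sums_mult[OF G[OF l], of "2 * pi"] by (simp add: sums_iff)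
    finally show ?thesis by (simp add: S_def)
  qed
  show ?thesis
    unfolding outer_hardy2_def
  proof (intro conjI exI ballI allI hardy)
    show "cmod 1 = 1" by simp
    show "(\<lambda>t. exp (- U t)) \<in> borel_measurable lebesgue" by measurable
    show "set_integrable lebesgue {0..2*pi} (\<lambda>t. ln (exp (- U t)))"
      using Uint by (simp add: I_def set_integrable_def)
    fix l :: complex assume "l \<in> ball 0 1"
    then have l: "cmod l < 1" by simp
    have "(LINT t:{0..2*pi}|lebesgue. (cis t + l) / (cis t - l) * complex_of_real (ln (exp (- U t)))) = - (2 * pi * G l)"
      unfolding main[OF l, symmetric] I_def by (simp add: set_lebesgue_integral_def)
    then show "g l = 1 * exp (complex_of_real (1 / (2 * pi)) *
        (LINT t:{0..2*pi}|lebesgue. (cis t + l) / (cis t - l) * complex_of_real (ln (exp (- U t)))))"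
      using g[OF l] by simp
  qed simp
qed

section \<open>Non-cyclic functions with outer slices\<close>

lemma cantor_slice_in_hardy2:
  assumes c: "cmod c \<le> 1"
  shows "(\<lambda>l. cantor_outer (c * l\<^sup>2)) \<in> hardy2"
proof -
  define a where "a n = (if even n then cantor_coeff (n div 2) * c ^ (n div 2) else 0)" for n
  have mono: "strict_mono (\<lambda>m :: nat. 2 * m)" by (simp add: strict_mono_def)
  have off: "n \<notin> range (\<lambda>m. 2 * m) \<Longrightarrow> a n = 0" for n by (auto simp: a_def elim!: evenE)
  have on: "a (2 * m) = cantor_coeff m * c ^ m" for m by (simp add: a_def)
  have "summable (\<lambda>m. (cmod (a (2 * m)))\<^sup>2)"
  proof (rule summable_comparison_test'[OF cantor_coeff_DA_summable])
    fix m
    have "(cmod (a (2 * m)))\<^sup>2 = (cmod (cantor_coeff m))\<^sup>2 * (cmod c ^ m)\<^sup>2"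
      by (simp add: on norm_mult norm_power power_mult_distrib)
    also have "\<dots> \<le> (cmod (cantor_coeff m))\<^sup>2 * 1"
      using c by (intro mult_left_mono power_le_one) auto
    also have "\<dots> \<le> diag_weight 2 m * (cmod (cantor_coeff m))\<^sup>2"
    proof -
      have "1 \<le> (real m + 1) powr ((real 2 - 1) / 2)" by (rule ge_one_powr_ge_zero) auto
      also have "\<dots> \<le> diag_weight 2 m" by (rule diag_weight_ge) simp
      finally show ?thesis using mult_right_mono[of 1 "diag_weight 2 m" "(cmod (cantor_coeff m))\<^sup>2"] by simp
    qed
    finally show "norm ((cmod (a (2 * m)))\<^sup>2) \<le> diag_weight 2 m * (cmod (cantor_coeff m))\<^sup>2" by simp
  qed
  then have "summable (\<lambda>n. (cmod (a n))\<^sup>2)"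
    by (subst (asm) summable_mono_reindex[OF mono, of "\<lambda>n. (cmod (a n))\<^sup>2"]) (auto simp: off)
  moreover have "(\<lambda>n. a n * l ^ n) sums cantor_outer (c * l\<^sup>2)" if l: "l \<in> ball 0 1" for l
  proof -
    have "cmod (c * l\<^sup>2) = cmod c * (cmod l)\<^sup>2" by (simp add: norm_mult norm_power)
    also have "\<dots> \<le> 1 * (cmod l)\<^sup>2" by (rule mult_right_mono[OF c]) simp
    also have "\<dots> < 1" using l by (simp add: power_less_one_iff)
    finally have "(\<lambda>m. cantor_coeff m * (c * l\<^sup>2) ^ m) sums cantor_outer (c * l\<^sup>2)"
      by (intro cantor_outer_sums) simp
    moreover have "cantor_coeff m * (c * l\<^sup>2) ^ m = a (2 * m) * l ^ (2 * m)" for m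
      by (simp add: on power_mult_distrib power_mult)
    ultimately have "(\<lambda>m. a (2 * m) * l ^ (2 * m)) sums cantor_outer (c * l\<^sup>2)" by (simp only:)
    then show ?thesis
      by (subst (asm) sums_mono_reindex[OF mono, of "\<lambda>n. a n * l ^ n"]) (auto simp: off)
  qed
  ultimately show ?thesis unfolding hardy2_def by blast
qed

text \<open>
  Composition with \<open>c l\<^sup>2\<close> maps the closed disc into itself, where each kernel is holomorphic; its value at \<open>0\<close> is
  real.
\<close>

lemma outer_cantor_slice:
  assumes c: "cmod c \<le> 1"
  shows "outer_hardy2 (\<lambda>l. cantor_outer (c * l\<^sup>2))"
proof (rule outer_exp_neg_sum[where h = "\<lambda>k l. (4/9) ^ k * cantor_kernel 0 k (c * l\<^sup>2)"
      and G = "\<lambda>l. cantor_potential 0 (c * l\<^sup>2)"])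
  have le: "cmod (c * l\<^sup>2) \<le> (cmod l)\<^sup>2" for l
    using mult_right_mono[OF c, of "(cmod l)\<^sup>2"] by (simp add: norm_mult norm_power)
  have le1: "cmod (c * l\<^sup>2) \<le> 1" if "cmod l \<le> 1" for l
    using le[of l] power_le_one[of "cmod l" 2] that by simp
  have lt1: "cmod (c * l\<^sup>2) < 1" if "cmod l < 1" for l
    using le[of l] that power_less_one_iff[of "cmod l" 2] by simp
  have d: "\<exists>D. ((\<lambda>l. (4/9) ^ k * cantor_kernel 0 k (c * l\<^sup>2)) has_field_derivative D) (at l)" 
    if "cmod l \<le> 1" for k l
  proof -
    have "((\<lambda>l. c * l\<^sup>2) has_field_derivative c * (2 * l)) (at l)"
      by (auto intro!: derivative_eq_intros)
    then show ?thesis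
      using DERIV_cmult[OF DERIV_chain2[where f = "cantor_kernel 0 k" and g = "\<lambda>l. c * l\<^sup>2",
          OF cantor_kernel_derivative[OF le1[OF that]]]] by blast
  qed
  show "continuous_on (cball 0 1) (\<lambda>l. (4/9) ^ k * cantor_kernel 0 k (c * l\<^sup>2))" for k
  proof (rule continuous_at_imp_continuous_on, rule ballI)
    fix l :: complex assume "l \<in> cball 0 1"
    then have "cmod l \<le> 1" by simp
    from d[OF this] show "isCont (\<lambda>l. (4/9) ^ k * cantor_kernel 0 k (c * l\<^sup>2)) l"
      using DERIV_isCont by blast
  qed
  show "(\<lambda>l. (4/9) ^ k * cantor_kernel 0 k (c * l\<^sup>2)) holomorphic_on ball 0 1" for k
    unfolding holomorphic_on_open[OF open_ball]
    by (intro ballI d) simp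
  have real: "(4/9 :: complex) ^ k = of_real ((4/9) ^ k)" for k by simp
  show "0 \<le> Re ((4/9) ^ k * cantor_kernel 0 k (c * l\<^sup>2))" if "cmod l = 1" for k l
    unfolding real using Re_cantor_kernel_nonneg[OF le1, of l k] that by simp
  show "Im ((4/9) ^ k * cantor_kernel 0 k (c * 0\<^sup>2)) = 0" for k
  proof -
    have "cantor_kernel 0 k (c * 0\<^sup>2) = of_real (\<Sum>A\<in>Pow {..<k}. inverse (1 + (1/3) ^ k))"
      by (simp add: cantor_kernel_def)
    then show ?thesis unfolding real by (simp only: of_real_mult[symmetric] Im_complex_of_real)
  qed
  show "(\<lambda>k. (4/9) ^ k * cantor_kernel 0 k (c * l\<^sup>2)) sums cantor_potential 0 (c * l\<^sup>2)" if "cmod l < 1" for l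
    by (rule cantor_potential_sums[OF lt1[OF that]])
  show "cantor_outer (c * l\<^sup>2) = exp (- cantor_potential 0 (c * l\<^sup>2))" for l
    by (simp add: cantor_outer_def)
qed (rule cantor_slice_in_hardy2[OF c])

lemma peak_scale: "peak J (l *s z) = l ^ card J * peak J z"
  by (simp add: peak_def prod.distrib mult_ac)

lemma slice_cantor_outer:
  fixes J :: "'d::finite set"
  assumes J: "card J = 2" and z: "z \<in> sphere 0 1"
  shows "outer_hardy2 (slice (\<lambda>z. cantor_outer (peak J z)) z)"
proof -
  have "J \<noteq> {}" using J by auto
  then have "cmod (peak J z) \<le> 1" using norm_peak_le[of J z] z by simp
  from outer_cantor_slice[OF this] show ?thesis
    by (simp add: slice_def[abs_def] peak_scale J mult.commute)
qed

lemma cantor_outer_peak_in_drury_arveson: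
  fixes J :: "'d::finite set"
  assumes J: "card J = 2"
  shows "(\<lambda>z. cantor_outer (peak J z)) \<in> drury_arveson"
proof (rule drury_arveson_compose_peak[OF _ cantor_outer_sums])
  show "J \<noteq> {}" using J by auto
  show "summable (\<lambda>m. diag_weight (card J) m * (cmod (cantor_coeff m))\<^sup>2)"
    unfolding J by (rule cantor_coeff_DA_summable)
qed

text \<open>
  The functional given by the Cantor measure has the value \<open>1\<close> at the constant function \<open>1\<close>.
\<close>

lemma cantor_outer_peak_not_cyclic:
  fixes J :: "'d::finite set"
  assumes J: "card J = 2"
  shows "\<not> cyclic (\<lambda>z. cantor_outer (peak J z))"
proof -
  have ne: "J \<noteq> {}" using J by auto
  have e: "(real (card J) - 1) / 4 = 1/4" using J by simp
  have "(\<lambda>z. (\<lambda>_. 1) (peak J z)) \<notin> inv_subspace (\<lambda>z. cantor_outer (peak J z))"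
  proof (rule not_in_inv_subspace[OF ne cantor_outer_sums, where g = "\<lambda>m. if m = 0 then 1 else 0" and \<nu> = cantor_limit and L = 1])
    show "(\<lambda>m. (if m = 0 then 1 else 0) * l ^ m) sums 1" for l :: complex
      using powser_sums_if[of 0 l] by (simp only: power_0)
    show "(\<lambda>m. cantor_limit m * (if m = 0 then 1 else 0)) sums 1"
      using sums_single[of 0 cantor_limit] by (simp add: if_distrib cantor_limit_0 cong: if_cong)
    show "summable (\<lambda>i. cmod (cantor_coeff i) * (real i + 1) powr ((real (card J) - 1) / 4))"
      unfolding e by (rule cantor_coeff_weighted_summable)
    show "summable (\<lambda>m. (cmod (cantor_limit m) / (real m + 1) powr ((real (card J) - 1) / 4))\<^sup>2)"
      unfolding e by (rule cantor_limit_square_summable)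
    show "(\<lambda>i. cantor_coeff i * cantor_limit (i + j)) sums 0" for j
      by (rule cantor_outer_annihilated)
  qed (use cantor_outer_peak_in_drury_arveson[OF J] const_in_drury_arveson in auto)
  then show ?thesis unfolding cyclic_def using const_in_drury_arveson[of 1] by auto
qed

theorem proposition4p4:
  shows "(CARD('d::finite) \<ge> 2 \<longrightarrow>
            (\<exists>f :: complex ^ 'd \<Rightarrow> complex. f \<in> drury_arveson \<and> \<not> cyclic f \<and>
               (\<forall>z\<in>sphere 0 1. outer_hardy2 (slice f z))))
       \<and> (\<forall>(k::nat) (n::nat) (e :: nat \<Rightarrow> 'd).
            bij_betw e {1..CARD('d)} UNIV \<and> CARD('d) \<ge> k \<and> k \<ge> 4 * n \<and> 4 * n > 0 \<longrightarrow>
              T_op e k (\<lambda>l. 1 - l) \<notin> cyclicity_class (n - 1)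
            \<and> \<not> (stable_polynomials :: (complex ^ 'd \<Rightarrow> complex) set) \<subseteq> cyclicity_class (n - 1))"
proof (intro conjI impI allI)
  assume "CARD('d) \<ge> 2"
  then obtain J :: "'d set" where J: "card J = 2"
    using obtain_subset_with_card_n[of 2 "UNIV :: 'd set"] by auto
  show "\<exists>f :: complex ^ 'd \<Rightarrow> complex. f \<in> drury_arveson \<and> \<not> cyclic f \<and>
               (\<forall>z\<in>sphere 0 1. outer_hardy2 (slice f z))"
    using cantor_outer_peak_in_drury_arveson[OF J] cantor_outer_peak_not_cyclic[OF J] slice_cantor_outer[OF J]
    by blast
next
  fix k n :: nat and e :: "nat \<Rightarrow> 'd"
  assume *: "bij_betw e {1..CARD('d)} UNIV \<and> CARD('d) \<ge> k \<and> k \<ge> 4 * n \<and> 4 * n > 0"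
  define J where "J = e ` {1..k}"
  have inj: "inj_on e {1..k}"
    by (rule inj_on_subset[of e "{1..CARD('d)}"]) (use * in \<open>auto simp: bij_betw_def\<close>)
  have T: "T_op e k (\<lambda>l. 1 - l) = (\<lambda>z. 1 - peak J z)"
    unfolding T_op_def tau_eq_peak(1)[OF inj] J_def by (simp add: o_def)
  have card: "card J = k" unfolding J_def by (rule tau_eq_peak(2)[OF inj])
  have ne: "J \<noteq> {}" using card * by auto
  have n: "n - 1 + 1 = n" using * by simp
  show notin: "T_op e k (\<lambda>l. 1 - l) \<notin> cyclicity_class (n - 1)"
    using one_minus_peak_powers_differ[of n J] * card unfolding T cyclicity_class_def n by simp
  show "\<not> (stable_polynomials :: (complex ^ 'd \<Rightarrow> complex) set) \<subseteq> cyclicity_class (n - 1)"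
    using notin one_minus_peak_stable[OF ne] unfolding T by blast
qed

end
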